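(* Let $C\in\operatorname{Sym}^{++}(n)$. 1. All geodesics (for the Wasserstein Riemannian metric) emanating from $C$ are of the form $\Sigma(\theta)=\operatorname{Exp}_C(\theta V)$, $V\in\operatorname{Sym}(n)$, with $\theta\in J_V$, where $J_V$ is the open interval about the origin $$J_V=\left\{\theta\in\mathbb R:\ I+\theta\,\mathcal L_C[V]\in\operatorname{Sym}^{++}(n)\right\}.$$ 2. The map $V\mapsto\operatorname{Exp}_C(V)$, restricted to the open set $$\Theta=\left\{V\in\operatorname{Sym}(n):\ I+\mathcal L_C[V]\in\operatorname{Sym}^{++}(n)\right\},$$ is a diffeomorphism of $\Theta$ into $\operatorname{Sym}^{++}(n)$ with inverse $$\operatorname{Log}_C(B)=(BC)^{1/2}+(CB)^{1/2}-2C .$$ 3. The derivative of the Riemannian exponential $V\mapsto\operatorname{Exp}_C(V)$ in the direction $X\in\operatorname{Sym}(n)$ is $$d_X\left(V\mapsto\operatorname{Exp}_C(V)\right)=X+\mathcal L_C[X]\,C\,\mathcal L_C[V]+\mathcal L_C[V]\,C\,\mathcal L_C[X].$$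
   Context: $\operatorname{Sym}(n)$ is the space of real symmetric $n\times n$ matrices, $\operatorname{Sym}^{++}(n)$ the open cone of positive-definite ones, with tangent space at each point identified with $\operatorname{Sym}(n)$. For $C\in\operatorname{Sym}^{++}(n)$ and $V\in\operatorname{Sym}(n)$, $\mathcal L_C[V]$ is the unique $X\in\operatorname{Sym}(n)$ with $XC+CX=V$. The Wasserstein Riemannian metric on $\operatorname{Sym}^{++}(n)$ is $W_\Sigma(U,V)=\operatorname{Tr}(\mathcal L_\Sigma[U]\Sigma\mathcal L_\Sigma[V])$. The Wasserstein Riemannian exponential is defined by $$\operatorname{Exp}_C(V)=C+V+\mathcal L_C[V]\,C\,\mathcal L_C[V]=(\mathcal L_C[V]+I)\,C\,(\mathcal L_C[V]+I).$$ For $A,B\in\operatorname{Sym}^{++}(n)$ the product $AB$ has positive eigenvalues and $(AB)^{1/2}=A^{1/2}(A^{1/2}BA^{1/2})^{1/2}A^{-1/2}$ denotes its square root (with positive eigenvalues). *)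

theory Defs
  imports "HOL-Analysis.Analysis"
begin

section \<open>Smooth maps on relatively open subsets of a linear subspace\<close>

text \<open>
  \<open>S\<close> is a linear subspace of the ambient space (the tangent space), \<open>U\<close> is a subset of \<open>S\<close>
  that is open relative to \<open>S\<close>. The filter \<open>at x within U\<close> determines a derivative only on \<open>S\<close>,
  hence higher derivatives are taken only in directions \<open>v \<in> S\<close>.
\<close>

primrec Ck_on ::
  "nat \<Rightarrow> 'a::euclidean_space set \<Rightarrow> 'a set \<Rightarrow> ('a \<Rightarrow> 'b::real_normed_vector) \<Rightarrow> bool"
where
  "Ck_on 0 S U f \<longleftrightarrow> continuous_on U f"
| "Ck_on (Suc k) S U f \<longleftrightarrow>
     (\<exists>f'. (\<forall>x\<in>U. (f has_derivative f' x) (at x within U)) \<and>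
           (\<forall>v\<in>S. Ck_on k S U (\<lambda>x. f' x v)))"

definition smooth_on ::
  "'a::euclidean_space set \<Rightarrow> 'a set \<Rightarrow> ('a \<Rightarrow> 'b::real_normed_vector) \<Rightarrow> bool"
where
  "smooth_on S U f \<longleftrightarrow> (\<forall>k. Ck_on k S U f)"

definition diffeomorphism ::
  "'a::euclidean_space set \<Rightarrow> 'a set \<Rightarrow> 'a set \<Rightarrow> ('a \<Rightarrow> 'a) \<Rightarrow> ('a \<Rightarrow> 'a) \<Rightarrow> bool"
where
  "diffeomorphism S U M f g \<longleftrightarrow>
     openin (top_of_set S) U \<and> openin (top_of_set S) M \<and>
     homeomorphism U M f g \<and> smooth_on S U f \<and> smooth_on S M g"

section \<open>Geodesics of a Riemannian metric on an open subset of a linear subspace\<close>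

text \<open>
  The manifold is an open subset \<open>M\<close> of the linear subspace \<open>S\<close>, so it has one global chart and
  every tangent space is \<open>S\<close>. A metric is a function \<open>g\<close>, with \<open>g p u v\<close> the inner product of the
  tangent vectors \<open>u\<close> and \<open>v\<close> at \<open>p\<close>.
\<close>

definition metric_deriv ::
  "('a::real_normed_vector \<Rightarrow> 'a \<Rightarrow> 'a \<Rightarrow> real) \<Rightarrow> 'a \<Rightarrow> 'a \<Rightarrow> 'a \<Rightarrow> 'a \<Rightarrow> real"
where
  "metric_deriv g p z u v = deriv (\<lambda>t. g (p + t *\<^sub>R z) u v) 0"

text \<open>
  Christoffel symbols of the Levi-Civita connection, as a vector-valued bilinear map in the global
  chart. This is the Koszul formula for constant vector fields, whose Lie brackets vanish.
\<close>

definition christoffel ::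
  "'a::real_normed_vector set \<Rightarrow> ('a \<Rightarrow> 'a \<Rightarrow> 'a \<Rightarrow> real) \<Rightarrow> 'a \<Rightarrow> 'a \<Rightarrow> 'a \<Rightarrow> 'a"
where
  "christoffel S g p u v =
     (THE w. w \<in> S \<and>
        (\<forall>x\<in>S. g p w x =
           (metric_deriv g p u v x + metric_deriv g p v u x - metric_deriv g p x u v) / 2))"

definition covariant_deriv_along ::
  "'a::real_normed_vector set \<Rightarrow> ('a \<Rightarrow> 'a \<Rightarrow> 'a \<Rightarrow> real) \<Rightarrow> (real \<Rightarrow> 'a) \<Rightarrow> (real \<Rightarrow> 'a) \<Rightarrow> real \<Rightarrow> 'a"
where
  "covariant_deriv_along S g \<gamma> Y t =
     vector_derivative Y (at t) + christoffel S g (\<gamma> t) (vector_derivative \<gamma> (at t)) (Y t)"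

definition geodesic_on ::
  "'a::euclidean_space set \<Rightarrow> 'a set \<Rightarrow> ('a \<Rightarrow> 'a \<Rightarrow> 'a \<Rightarrow> real) \<Rightarrow> real set \<Rightarrow> (real \<Rightarrow> 'a) \<Rightarrow> bool"
where
  "geodesic_on S M g J \<gamma> \<longleftrightarrow>
     open J \<and> is_interval J \<and> \<gamma> ` J \<subseteq> M \<and> smooth_on UNIV J \<gamma> \<and>
     (\<forall>t\<in>J. covariant_deriv_along S g \<gamma> (\<lambda>s. vector_derivative \<gamma> (at s)) t = 0)"

section \<open>The Wasserstein geometry of positive-definite matrices\<close>

definition Sym :: "(real^'n^'n) set" where
  "Sym = {A. transpose A = A}"

definition SPD :: "(real^'n^'n) set" where
  "SPD = {A \<in> Sym. \<forall>x. x \<noteq> 0 \<longrightarrow> 0 < x \<bullet> (A *v x)}"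

text \<open>For positive-definite \<open>C\<close> and symmetric \<open>V\<close>, the symmetric solution of the Lyapunov equation
  exists and is unique; for other arguments the value is unspecified.\<close>

definition lyap :: "real^'n^'n \<Rightarrow> real^'n^'n \<Rightarrow> real^'n^'n" where
  "lyap C V = (THE X. X \<in> Sym \<and> X ** C + C ** X = V)"

definition wasserstein :: "real^'n^'n \<Rightarrow> real^'n^'n \<Rightarrow> real^'n^'n \<Rightarrow> real" where
  "wasserstein \<Sigma> U V = trace (lyap \<Sigma> U ** \<Sigma> ** lyap \<Sigma> V)"

definition wExp :: "real^'n^'n \<Rightarrow> real^'n^'n \<Rightarrow> real^'n^'n" where
  "wExp C V = C + V + lyap C V ** C ** lyap C V"

definition spd_sqrt :: "real^'n^'n \<Rightarrow> real^'n^'n" where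
  "spd_sqrt A = (THE R. R \<in> SPD \<and> R ** R = A)"

text \<open>For positive-definite \<open>A\<close> and \<open>B\<close> this is the square root of \<open>A ** B\<close> with positive
  eigenvalues, in general not symmetric; \<open>A ** B\<close> is conjugated by the square root of \<open>A\<close> to a
  positive-definite matrix.\<close>

definition prod_sqrt :: "real^'n^'n \<Rightarrow> real^'n^'n \<Rightarrow> real^'n^'n" where
  "prod_sqrt A B =
     spd_sqrt A ** spd_sqrt (spd_sqrt A ** B ** spd_sqrt A) ** matrix_inv (spd_sqrt A)"

definition wLog :: "real^'n^'n \<Rightarrow> real^'n^'n \<Rightarrow> real^'n^'n" where
  "wLog C B = prod_sqrt B C + prod_sqrt C B - 2 *\<^sub>R C"

definition geo_interval :: "real^'n^'n \<Rightarrow> real^'n^'n \<Rightarrow> real set" where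
  "geo_interval C V = {\<theta>. mat 1 + \<theta> *\<^sub>R lyap C V \<in> SPD}"

definition exp_domain :: "real^'n^'n \<Rightarrow> (real^'n^'n) set" where
  "exp_domain C = {V \<in> Sym. mat 1 + lyap C V \<in> SPD}"

end

theory Submission
  imports Defs
begin

text \<open>
  Write \<open>L\<close> for the solution of the Lyapunov equation \<open>L ** C + C ** L = V\<close>. Then
  \<open>wExp C V = T ** C ** T\<close> with \<open>T = mat 1 + L\<close>, and \<open>V = T ** C + C ** T - 2 *\<^sub>R C\<close> is recovered from
  \<open>T\<close>. So inverting the exponential on its domain means solving the Riccati equation
  \<open>T ** C ** T = B\<close> for a positive-definite \<open>T\<close>. Conjugation by the square root of \<open>C\<close> turns that
  into the extraction of a square root, which exists, is unique and depends smoothly on \<open>B\<close>; and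
  the two product roots in \<open>wLog C B\<close> are \<open>T ** C\<close> and \<open>C ** T\<close> (\<open>prod_sqrt_eq\<close>, \<open>riccati_root\<close>,
  \<open>wLog_eq\<close>). The derivative of the exponential is a product rule, as \<open>L\<close> is linear in \<open>V\<close>.

  Smoothness rests on two observations. The solution operator of the Lyapunov equation is part of
  the inverse of an injective map with invertible derivative on an open set, so it is differentiable, and its derivative is again expressed
  by the same operator (\<open>has_derivative_lyap_solve\<close>). The derivative of the matrix square root is the
  Lyapunov operator at the root (\<open>has_derivative_pd_sqrt\<close>). Both facts bootstrap to all orders
  (\<open>Ck_on_lyap_solve\<close>, \<open>Ck_on_spd_sqrt\<close>).

  For the geodesics, the metric is \<open>wasserstein p u v = (lyap_solve p u \<bullet> v) / 2\<close> with the Frobenius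
  inner product. Differentiating the Lyapunov equation gives its derivative in \<open>p\<close>, and the Koszul
  formula yields the geodesic equation \<open>\<gamma>'' = 2 U \<gamma> U\<close>, where \<open>U = lyap_solve \<gamma> \<gamma>'\<close>
  (\<open>christoffel_wasserstein\<close>). That \<open>\<gamma> = P ** C ** P\<close> with \<open>P = mat 1 + t *\<^sub>R L\<close> satisfies it is a
  calculation (\<open>geodesic_wExp\<close>). Conversely, the equation says exactly that \<open>U' = - U ** U\<close> along
  any geodesic. This matrix Riccati equation integrates to \<open>P ** U = L\<close>, and then \<open>\<gamma>\<close> and
  \<open>P ** C ** P\<close> solve the same linear equation with the same initial value. Since \<open>P ** U = U ** P = L\<close>
  forces \<open>P\<close> to be injective, \<open>P\<close> stays positive definite on the whole interval of the geodesic
  (\<open>geodesic_eq_wExp\<close>).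
\<close>

section \<open>Matrix products and the Frobenius inner product\<close>

text \<open>Quadratic forms are handled below with all matrices acting from the left; the default rewriting to
  \<open>v*\<close> would break this.\<close>
declare transpose_matrix_vector [simp del]

lemma bounded_bilinear_matrix_mult:
  "bounded_bilinear ((**) :: real^'n^'n \<Rightarrow> real^'n^'n \<Rightarrow> real^'n^'n)"
  unfolding bilinear_conv_bounded_bilinear[symmetric] bilinear_def
  by (auto intro!: linearI simp: matrix_matrix_mult_def vec_eq_iff algebra_simps
      sum.distrib scaleR_sum_right sum_distrib_left)

lemma bounded_bilinear_matrix_vector_mult:
  "bounded_bilinear ((*v) :: real^'n^'n \<Rightarrow> real^'n \<Rightarrow> real^'n)"
  unfolding bilinear_conv_bounded_bilinear[symmetric] bilinear_def
  by (auto intro!: linearI simp: matrix_vector_mult_def vec_eq_iff algebra_simps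
      sum.distrib scaleR_sum_right sum_distrib_left)

lemma bounded_linear_transpose: "bounded_linear (transpose :: real^'n^'n \<Rightarrow> real^'n^'n)"
  unfolding linear_conv_bounded_linear[symmetric]
  by (auto intro!: linearI simp: transpose_def vec_eq_iff)

lemmas matrix_mult_simps =
  bounded_bilinear.add_left[OF bounded_bilinear_matrix_mult]
  bounded_bilinear.add_right[OF bounded_bilinear_matrix_mult]
  bounded_bilinear.diff_left[OF bounded_bilinear_matrix_mult]
  bounded_bilinear.diff_right[OF bounded_bilinear_matrix_mult]
  bounded_bilinear.minus_left[OF bounded_bilinear_matrix_mult]
  bounded_bilinear.minus_right[OF bounded_bilinear_matrix_mult]
  bounded_bilinear.scaleR_left[OF bounded_bilinear_matrix_mult]
  bounded_bilinear.scaleR_right[OF bounded_bilinear_matrix_mult]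
  matrix_mul_assoc

lemmas matrix_vector_simps =
  bounded_bilinear.add_left[OF bounded_bilinear_matrix_vector_mult]
  bounded_bilinear.diff_left[OF bounded_bilinear_matrix_vector_mult]
  bounded_bilinear.scaleR_left[OF bounded_bilinear_matrix_vector_mult]
  bounded_bilinear.scaleR_right[OF bounded_bilinear_matrix_vector_mult]
  bounded_bilinear.minus_right[OF bounded_bilinear_matrix_vector_mult]

lemmas transpose_simps =
  linear_add[OF bounded_linear.linear[OF bounded_linear_transpose]]
  linear_diff[OF bounded_linear.linear[OF bounded_linear_transpose]]
  linear_neg[OF bounded_linear.linear[OF bounded_linear_transpose]]
  linear_cmul[OF bounded_linear.linear[OF bounded_linear_transpose]]
  matrix_transpose_mul

lemmas continuous_on_matrix_mult [continuous_intros] =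
  bounded_bilinear.continuous_on[OF bounded_bilinear_matrix_mult]
lemmas continuous_on_matrix_vector_mult [continuous_intros] =
  bounded_bilinear.continuous_on[OF bounded_bilinear_matrix_vector_mult]
lemmas has_derivative_matrix_mult [derivative_intros] =
  bounded_bilinear.FDERIV[OF bounded_bilinear_matrix_mult]
lemmas has_vector_derivative_matrix_mult =
  bounded_bilinear.has_vector_derivative[OF bounded_bilinear_matrix_mult]

text \<open>The inner product that the type \<open>real^'n^'n\<close> carries is the Frobenius one, so traces of
  products can be rewritten as inner products and moved around by adjunction.\<close>
lemma trace_matrix_mult_eq_inner:
  fixes A B :: "real^'n^'n"
  shows "trace (A ** B) = transpose A \<bullet> B"
  unfolding trace_def matrix_matrix_mult_def transpose_def inner_vec_def
  by (simp, subst sum.swap, rule refl)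

lemma inner_transpose_transpose:
  fixes A B :: "real^'n^'n"
  shows "transpose A \<bullet> transpose B = A \<bullet> B"
  unfolding inner_vec_def transpose_def by (simp, subst sum.swap, rule refl)

lemma inner_matrix_mult_left:
  fixes A B D :: "real^'n^'n"
  shows "(A ** B) \<bullet> D = B \<bullet> (transpose A ** D)"
proof -
  have "(A ** B) \<bullet> D = trace (transpose (A ** B) ** D)"
    by (simp add: trace_matrix_mult_eq_inner)
  also have "\<dots> = trace (transpose B ** (transpose A ** D))"
    by (simp add: matrix_transpose_mul matrix_mul_assoc)
  finally show ?thesis by (simp add: trace_matrix_mult_eq_inner)
qed

lemma inner_matrix_mult_right:
  fixes A B D :: "real^'n^'n"
  shows "(A ** B) \<bullet> D = A \<bullet> (D ** transpose B)"
proof -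
  have "(A ** B) \<bullet> D = (transpose B ** transpose A) \<bullet> transpose D"
    by (metis inner_transpose_transpose matrix_transpose_mul)
  also have "\<dots> = transpose A \<bullet> transpose (D ** transpose B)"
    by (simp add: inner_matrix_mult_left matrix_transpose_mul)
  finally show ?thesis by (simp add: inner_transpose_transpose)
qed

section \<open>Matrices with a positive quadratic form\<close>

text \<open>Symmetry is left out on purpose: \<open>PD\<close> is open in the full matrix space, so theorems about open
  subsets of a Euclidean space apply to it, and restriction to \<open>Sym\<close> then gives the statements
  about \<open>SPD\<close>.\<close>
definition PD :: "(real^'n^'n) set" where
  "PD = {A. \<forall>x. x \<noteq> 0 \<longrightarrow> 0 < x \<bullet> (A *v x)}"

lemma SPD_eq: "SPD = Sym \<inter> PD"
  by (auto simp: SPD_def PD_def)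

lemma Sym_iff: "A \<in> Sym \<longleftrightarrow> transpose A = A"
  by (simp add: Sym_def)

lemma subspace_Sym: "subspace Sym"
  by (auto simp: subspace_def Sym_def transpose_simps) (simp add: transpose_def vec_eq_iff)

lemmas Sym_add = subspace_add[OF subspace_Sym]
lemmas Sym_diff = subspace_diff[OF subspace_Sym]
lemmas Sym_scaleR = subspace_scale[OF subspace_Sym]

lemma inner_transpose_mult_vec:
  fixes A :: "real^'n^'n"
  shows "x \<bullet> (transpose A *v y) = y \<bullet> (A *v x)"
  by (metis dot_lmul_matrix inner_commute vector_transpose_matrix transpose_transpose)

lemma PD_transpose: "A \<in> PD \<Longrightarrow> transpose A \<in> PD"
  unfolding PD_def by (auto simp: inner_transpose_mult_vec)

lemma PD_add: "A \<in> PD \<Longrightarrow> B \<in> PD \<Longrightarrow> A + B \<in> PD"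
  by (auto simp: PD_def matrix_vector_simps inner_add_right add_pos_pos)

lemma PD_scaleR: "A \<in> PD \<Longrightarrow> 0 < c \<Longrightarrow> c *\<^sub>R A \<in> PD"
  by (auto simp: PD_def matrix_vector_simps)

lemma mat_1_in_PD: "mat 1 \<in> PD"
  by (auto simp: PD_def)

lemma convex_PD: "convex PD"
  unfolding convex_alt
proof (intro ballI allI impI)
  fix A B :: "real^'n^'n" and u :: real assume *: "A \<in> PD" "B \<in> PD" "0 \<le> u \<and> u \<le> 1"
  show "(1 - u) *\<^sub>R A + u *\<^sub>R B \<in> PD"
  proof (cases "u = 0 \<or> u = 1")
    case True then show ?thesis using * by auto
  next
    case False then show ?thesis using * by (auto intro!: PD_add PD_scaleR)
  qed
qed

text \<open>The form attains a minimum on the unit sphere, and scaling carries the bound to all vectors.\<close>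
lemma PD_coercive:
  fixes A :: "real^'n^'n"
  assumes "A \<in> PD"
  obtains c where "0 < c" "\<And>x. c * (norm x)\<^sup>2 \<le> x \<bullet> (A *v x)"
proof -
  have "compact (sphere 0 1 :: (real^'n) set)" by simp
  moreover have "sphere 0 1 \<noteq> ({} :: (real^'n) set)" by simp
  moreover have "continuous_on (sphere 0 1) (\<lambda>x::real^'n. x \<bullet> (A *v x))"
    by (intro continuous_intros)
  ultimately obtain z :: "real^'n"
    where z: "z \<in> sphere 0 1" "\<And>y. y \<in> sphere 0 1 \<Longrightarrow> z \<bullet> (A *v z) \<le> y \<bullet> (A *v y)"
    by (meson continuous_attains_inf)
  show ?thesis
  proof
    show "0 < z \<bullet> (A *v z)"
    proof -
      have "z \<noteq> 0" using z(1) by auto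
      then show ?thesis using assms by (simp add: PD_def)
    qed
    fix x :: "real^'n"
    show "z \<bullet> (A *v z) * (norm x)\<^sup>2 \<le> x \<bullet> (A *v x)"
    proof (cases "x = 0")
      case False
      have "z \<bullet> (A *v z) \<le> (x /\<^sub>R norm x) \<bullet> (A *v (x /\<^sub>R norm x))"
        using False by (intro z(2)) simp
      also have "\<dots> = (x \<bullet> (A *v x)) / (norm x)\<^sup>2"
        by (simp add: matrix_vector_simps power2_eq_square divide_simps)
      finally show ?thesis using False by (simp add: field_simps)
    qed simp
  qed
qed

lemma open_PD: "open (PD :: (real^'n^'n) set)"
  unfolding open_dist
proof
  fix A :: "real^'n^'n" assume "A \<in> PD"
  then obtain c where c: "0 < c" "\<And>x. c * (norm x)\<^sup>2 \<le> x \<bullet> (A *v x)" by (rule PD_coercive) blast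
  obtain K where K: "0 < K" "\<And>B (x::real^'n). norm (B *v x) \<le> norm (B::real^'n^'n) * norm x * K"
    using bounded_bilinear.pos_bounded[OF bounded_bilinear_matrix_vector_mult] by blast
  show "\<exists>e>0. \<forall>B. dist B A < e \<longrightarrow> B \<in> PD"
  proof (intro exI conjI allI impI)
    show "0 < c / K" using c K by simp
    fix B assume B: "dist B A < c / K"
    show "B \<in> PD" unfolding PD_def
    proof (clarify)
      fix x :: "real^'n" assume x: "x \<noteq> 0"
      have "\<bar>x \<bullet> ((B - A) *v x)\<bar> \<le> norm x * (norm (B - A) * norm x * K)"
        by (meson Cauchy_Schwarz_ineq2 K(2) mult_left_mono norm_ge_zero order_trans)
      also have "\<dots> = (norm (B - A) * K) * (norm x)\<^sup>2" by (simp add: power2_eq_square)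
      also have "\<dots> < c * (norm x)\<^sup>2"
        using B K x by (intro mult_strict_right_mono) (auto simp: dist_norm field_simps)
      also have "\<dots> \<le> x \<bullet> (A *v x)" by (rule c)
      finally show "0 < x \<bullet> (B *v x)" by (simp add: matrix_vector_simps inner_diff_right)
    qed
  qed
qed

lemma PD_nullspace: "A \<in> PD \<Longrightarrow> A *v x = 0 \<Longrightarrow> x = 0"
  unfolding PD_def by force

lemma PD_invertible: "A \<in> PD \<Longrightarrow> invertible A"
  unfolding invertible_left_inverse using PD_nullspace matrix_left_invertible_ker by blast

lemma PD_inverse:
  assumes "A \<in> PD" shows "A ** matrix_inv A = mat 1" "matrix_inv A ** A = mat 1"
  using someI_ex[of "\<lambda>B. A ** B = mat 1 \<and> B ** A = mat 1"] PD_invertible[OF assms]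
  unfolding matrix_inv_def invertible_def by auto

lemma inner_mult_eq_sum_columns:
  fixes A X :: "real^'n^'n"
  shows "X \<bullet> (A ** X) = (\<Sum>j\<in>UNIV. column j X \<bullet> (A *v column j X))"
  unfolding inner_vec_def column_def matrix_matrix_mult_def matrix_vector_mult_def
  by (simp, subst sum.swap, rule refl)

text \<open>Left multiplication by \<open>A\<close> acts on each column of \<open>X\<close> separately.\<close>
lemma inner_PD_mult_pos:
  fixes A X :: "real^'n^'n"
  assumes "A \<in> PD" "X \<noteq> 0"
  shows "0 < X \<bullet> (A ** X)"
proof -
  obtain j where j: "column j X \<noteq> 0"
    using assms(2) by (auto simp: column_def vec_eq_iff)
  have nonneg: "0 \<le> x \<bullet> (A *v x)" for x
    using assms(1) by (cases "x = 0") (auto simp: PD_def less_imp_le)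
  show ?thesis
    unfolding inner_mult_eq_sum_columns
    by (rule sum_pos2[of _ j]) (use assms(1) j nonneg in \<open>auto simp: PD_def\<close>)
qed

lemma inner_mult_PD_pos:
  fixes A X :: "real^'n^'n"
  assumes "A \<in> PD" "X \<noteq> 0"
  shows "0 < X \<bullet> (X ** A)"
proof -
  have "transpose X \<noteq> 0"
    using assms(2) transpose_iff[of X 0] linear_0[OF bounded_linear.linear[OF bounded_linear_transpose]]
    by metis
  then have "0 < transpose X \<bullet> (transpose A ** transpose X)"
    by (intro inner_PD_mult_pos PD_transpose assms)
  then show ?thesis by (metis inner_transpose_transpose matrix_transpose_mul)
qed

lemma PD_congruence:
  fixes A P :: "real^'n^'n"
  assumes "A \<in> PD" "invertible P"
  shows "transpose P ** A ** P \<in> PD"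
  unfolding PD_def
proof clarify
  fix x :: "real^'n" assume "x \<noteq> 0"
  then have "P *v x \<noteq> 0"
    using assms(2) invertible_left_inverse matrix_left_invertible_ker by blast
  then have "0 < (P *v x) \<bullet> (A *v (P *v x))" using assms(1) by (auto simp: PD_def)
  also have "\<dots> = (A *v (P *v x)) \<bullet> (P *v x)" by (rule inner_commute)
  also have "\<dots> = x \<bullet> (transpose P *v (A *v (P *v x)))"
    by (rule inner_transpose_mult_vec[symmetric])
  also have "\<dots> = x \<bullet> (transpose P ** A ** P *v x)" by (simp only: matrix_vector_mul_assoc matrix_mul_assoc)
  finally show "0 < x \<bullet> (transpose P ** A ** P *v x)" .
qed

lemma SPD_congruence:
  fixes A P :: "real^'n^'n"
  assumes "A \<in> SPD" "P \<in> SPD"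
  shows "P ** A ** P \<in> SPD"
  using assms PD_congruence[of A P] PD_invertible[of P]
  by (auto simp: SPD_eq Sym_iff transpose_simps matrix_mul_assoc)

lemma SPD_inverse:
  fixes P :: "real^'n^'n"
  assumes "P \<in> SPD" shows "matrix_inv P \<in> SPD"
proof -
  have PD: "P \<in> PD" and s: "transpose P = P" using assms by (auto simp: SPD_eq Sym_iff)
  let ?I = "matrix_inv P"
  have "transpose ?I ** P = transpose (P ** ?I)" by (simp add: matrix_transpose_mul s)
  then have 1: "transpose ?I ** P = mat 1" by (simp add: PD_inverse[OF PD])
  have "transpose ?I = transpose ?I ** (P ** ?I)" by (simp add: PD_inverse[OF PD])
  also have "\<dots> = ?I" by (simp add: matrix_mul_assoc 1)
  finally have tI: "transpose ?I = ?I" .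
  have "invertible ?I" using PD_inverse[OF PD] invertible_def by blast
  then have "transpose ?I ** P ** ?I \<in> PD" by (rule PD_congruence[OF PD])
  then show ?thesis using tI PD_inverse[OF PD] by (auto simp: SPD_eq Sym_iff)
qed

text \<open>A positive semidefinite form that vanishes at \<open>x\<close> has \<open>A *v x = 0\<close>, by minimality of \<open>0\<close> along
  the line from \<open>x\<close> in the direction \<open>A *v x\<close>. So an injective limit of positive-definite matrices
  is positive definite; this is the closedness half of both connectedness arguments below.\<close>
lemma SPD_of_nonneg:
  fixes A :: "real^'n^'n"
  assumes sym: "A \<in> Sym" and nonneg: "\<And>x. 0 \<le> x \<bullet> (A *v x)" and ker: "\<And>x. A *v x = 0 \<Longrightarrow> x = 0"
  shows "A \<in> SPD"
proof -
  have "0 < x \<bullet> (A *v x)" if "x \<noteq> 0" for x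
  proof (rule ccontr)
    assume "\<not> ?thesis"
    then have 0: "x \<bullet> (A *v x) = 0" using nonneg[of x] by simp
    let ?y = "A *v x"
    have yx: "?y \<bullet> (A *v y) = y \<bullet> (A *v ?y)" for y
      using sym inner_transpose_mult_vec[of ?y A y] by (simp add: Sym_iff)
    \<comment> \<open>The form is nonnegative at \<open>x - t *\<^sub>R ?y\<close> for all \<open>t\<close>, which fails for small \<open>t > 0\<close>
      unless \<open>?y = 0\<close>; \<open>t = a / (b + 1)\<close> is small enough.\<close>
    have "?y \<bullet> ?y = 0"
    proof (rule ccontr)
      assume n: "?y \<bullet> ?y \<noteq> 0"
      define a where "a = ?y \<bullet> ?y"
      define b where "b = ?y \<bullet> (A *v ?y)"
      have a: "a > 0" using n by (simp add: a_def)
      have b: "b \<ge> 0" using nonneg by (simp add: b_def)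
      have quad: "0 \<le> - 2 * t * a + t\<^sup>2 * b" for t
      proof -
        have "0 \<le> (x - t *\<^sub>R ?y) \<bullet> (A *v (x - t *\<^sub>R ?y))" by (rule nonneg)
        also have "\<dots> = x \<bullet> ?y - t * (x \<bullet> (A *v ?y)) - t * (?y \<bullet> ?y) + t\<^sup>2 * b"
          by (simp add: matrix_vector_mult_diff_distrib matrix_vector_simps inner_diff_left
              inner_diff_right b_def power2_eq_square algebra_simps)
        also have "x \<bullet> (A *v ?y) = a" using yx[of x] by (simp add: a_def)
        finally show ?thesis using 0 by (simp add: a_def)
      qed
      have "0 \<le> - 2 * (a / (b + 1)) * a + (a / (b + 1))\<^sup>2 * b" by (rule quad)
      also have "\<dots> = (a\<^sup>2 / (b + 1)\<^sup>2) * (b - 2 * (b + 1))"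
        using b by (simp add: power2_eq_square divide_simps) (simp add: algebra_simps)
      also have "\<dots> < 0" using a b by (intro mult_pos_neg) auto
      finally show False by simp
    qed
    then show False using ker that by simp
  qed
  then show ?thesis using sym by (simp add: SPD_def)
qed

section \<open>The Lyapunov equation\<close>

text \<open>Pairing the equation with \<open>X\<close> gives a sum of two nonnegative terms, both positive unless
  \<open>X = 0\<close>.\<close>
lemma PD_lyapunov_inj:
  fixes C X :: "real^'n^'n"
  assumes "C \<in> PD" "X ** C + C ** X = 0"
  shows "X = 0"
proof (rule ccontr)
  assume "X \<noteq> 0"
  then have "0 < X \<bullet> (X ** C) + X \<bullet> (C ** X)"
    by (intro add_pos_pos inner_mult_PD_pos inner_PD_mult_pos assms(1))
  also have "\<dots> = 0" using assms(2) by (metis inner_add_right inner_zero_right)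
  finally show False by simp
qed

text \<open>\<open>lyap C\<close> has a meaning on symmetric matrices only. Without the symmetry constraint the Lyapunov
  equation is still uniquely solvable, and its solution operator is linear on the whole matrix space,
  as derivatives in the ambient space have to be.\<close>
definition lyap_solve :: "real^'n^'n \<Rightarrow> real^'n^'n \<Rightarrow> real^'n^'n" where
  "lyap_solve C V = (THE X. X ** C + C ** X = V)"

lemma linear_lyapunov: "linear (\<lambda>X :: real^'n^'n. X ** C + C ** X)"
  by (auto intro!: linearI simp: matrix_mult_simps scaleR_add_right)

lemma lyapunov_ex1:
  fixes C V :: "real^'n^'n"
  assumes "C \<in> PD"
  shows "\<exists>!X. X ** C + C ** X = V"
proof -
  have "inj (\<lambda>X. X ** C + C ** X)"
    unfolding linear_injective_0[OF linear_lyapunov] using PD_lyapunov_inj[OF assms] by blast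
  then have "surj (\<lambda>X. X ** C + C ** X)"
    using linear_injective_imp_surjective[OF linear_lyapunov] by blast
  then obtain X where X: "X ** C + C ** X = V" unfolding surj_def by (metis (no_types))
  have "Y = X" if "Y ** C + C ** Y = V" for Y
    by (rule injD[OF \<open>inj _\<close>]) (simp add: that X)
  with X show ?thesis by (intro ex1I)
qed

lemma lyap_solve_eq:
  "C \<in> PD \<Longrightarrow> lyap_solve C V ** C + C ** lyap_solve C V = V"
  unfolding lyap_solve_def by (rule theI'[OF lyapunov_ex1])

lemma lyap_solve_unique:
  "C \<in> PD \<Longrightarrow> X ** C + C ** X = V \<Longrightarrow> lyap_solve C V = X"
  using lyapunov_ex1 lyap_solve_eq by blast

lemma bounded_linear_lyap_solve:
  fixes C :: "real^'n^'n"
  assumes "C \<in> PD" shows "bounded_linear (lyap_solve C)"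
  unfolding linear_conv_bounded_linear[symmetric]
proof (rule linearI; rule lyap_solve_unique[OF assms])
  fix V W :: "real^'n^'n" and r :: real
  let ?V = "lyap_solve C V" and ?W = "lyap_solve C W"
  have "(?V + ?W) ** C + C ** (?V + ?W) = (?V ** C + C ** ?V) + (?W ** C + C ** ?W)"
    by (simp add: matrix_mult_simps)
  then show "(?V + ?W) ** C + C ** (?V + ?W) = V + W" by (simp add: lyap_solve_eq[OF assms])
  have "(r *\<^sub>R ?V) ** C + C ** (r *\<^sub>R ?V) = r *\<^sub>R (?V ** C + C ** ?V)"
    by (simp add: matrix_mult_simps scaleR_add_right)
  then show "(r *\<^sub>R ?V) ** C + C ** (r *\<^sub>R ?V) = r *\<^sub>R V"
    by (simp add: lyap_solve_eq[OF assms])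
qed

lemma lyap_solve_Sym:
  assumes "C \<in> SPD" "V \<in> Sym" shows "lyap_solve C V \<in> Sym"
proof -
  have C: "C \<in> PD" "transpose C = C" using assms by (auto simp: SPD_eq Sym_iff)
  have "transpose (lyap_solve C V) ** C + C ** transpose (lyap_solve C V)
      = transpose (lyap_solve C V ** C + C ** lyap_solve C V)"
    by (simp add: transpose_simps C)
  also have "\<dots> = V" using lyap_solve_eq[OF C(1)] assms(2) by (simp add: Sym_iff)
  finally show ?thesis using lyap_solve_unique[OF C(1)] by (metis Sym_iff)
qed

lemma lyap_eq_lyap_solve:
  assumes "C \<in> SPD" "V \<in> Sym" shows "lyap C V = lyap_solve C V"
  unfolding lyap_def
proof (rule the_equality)
  show "lyap_solve C V \<in> Sym \<and> lyap_solve C V ** C + C ** lyap_solve C V = V"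
    using lyap_solve_Sym[OF assms] lyap_solve_eq assms by (auto simp: SPD_eq)
qed (use lyap_solve_unique[of C _ V] assms in \<open>auto simp: SPD_eq\<close>)

text \<open>The operator \<open>X \<mapsto> X ** C + C ** X\<close> is self-adjoint when \<open>C\<close> is symmetric, hence so is its inverse.\<close>
lemma lyap_solve_adjoint:
  fixes C A B :: "real^'n^'n"
  assumes "C \<in> SPD"
  shows "lyap_solve C A \<bullet> B = A \<bullet> lyap_solve C B"
proof -
  have C: "C \<in> PD" "transpose C = C" using assms by (auto simp: SPD_eq Sym_iff)
  let ?X = "lyap_solve C A" and ?Y = "lyap_solve C B"
  have "?X \<bullet> B = ?X \<bullet> (?Y ** C + C ** ?Y)" by (simp add: lyap_solve_eq C)
  also have "\<dots> = (?Y ** C) \<bullet> ?X + (C ** ?Y) \<bullet> ?X"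
    by (simp add: inner_add_right inner_commute)
  also have "\<dots> = ?Y \<bullet> (?X ** C) + ?Y \<bullet> (C ** ?X)"
    by (simp only: inner_matrix_mult_right[of ?Y C ?X] inner_matrix_mult_left[of C ?Y ?X] C)
  also have "\<dots> = (?X ** C + C ** ?X) \<bullet> ?Y"
    by (simp add: inner_add_right inner_commute)
  finally show ?thesis by (simp add: lyap_solve_eq C)
qed

text \<open>The map \<open>(R, X) \<mapsto> (R, X ** R + R ** X)\<close> is injective on the open set \<open>PD \<times> UNIV\<close> and has an invertible
  derivative there, so its inverse \<open>(R, H) \<mapsto> (R, lyap_solve R H)\<close> is differentiable. The formula comes from differentiating
  \<open>X ** R + R ** X = H\<close>.\<close>
lemma has_derivative_lyap_solve_pair:
  fixes R H :: "real^'n^'n"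
  assumes "R \<in> PD"
  defines "X \<equiv> lyap_solve R H"
  shows "((\<lambda>p. lyap_solve (fst p) (snd p)) has_derivative
      (\<lambda>q. lyap_solve R (snd q - (X ** fst q + fst q ** X)))) (at (R, H))"
proof -
  let ?f = "\<lambda>p::(real^'n^'n) \<times> (real^'n^'n). (fst p, snd p ** fst p + fst p ** snd p)"
  let ?f' = "\<lambda>q. (fst q, (X ** fst q + snd q ** R) + (R ** snd q + fst q ** X))"
  let ?g = "\<lambda>p. (fst p, lyap_solve (fst p) (snd p))"
  let ?g' = "\<lambda>q. (fst q, lyap_solve R (snd q - (X ** fst q + fst q ** X)))"
  have "(?g has_derivative ?g') (at (?f (R, X)))"
  proof (rule has_derivative_inverse_strong[where S = "PD \<times> UNIV" and f = ?f and g = ?g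
        and f' = ?f' and g' = ?g' and x = "(R, X)"])
    show "open (PD \<times> (UNIV :: (real^'n^'n) set))" by (intro open_Times open_PD open_UNIV)
    show "(R, X) \<in> PD \<times> UNIV" using assms by simp
    show "continuous_on (PD \<times> UNIV) ?f" by (intro continuous_intros)
    show "?g (?f p) = p" if "p \<in> PD \<times> UNIV" for p
      using that lyap_solve_unique[of "fst p" "snd p"] by (auto simp: prod_eq_iff)
    show "(?f has_derivative ?f') (at (R, X))"
      by (auto intro!: derivative_eq_intros)
    show "?f' \<circ> ?g' = id"
    proof
      fix q
      have "lyap_solve R W ** R + R ** lyap_solve R W = W" for W
        by (rule lyap_solve_eq[OF assms(1)])
      from this[of "snd q - (X ** fst q + fst q ** X)"]
      show "(?f' \<circ> ?g') q = id q" by (auto simp: prod_eq_iff algebra_simps)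
    qed
  qed
  moreover have "?f (R, X) = (R, H)" using lyap_solve_eq[OF assms(1)] by (simp add: X_def)
  ultimately have "(?g has_derivative ?g') (at (R, H))" by simp
  from has_derivative_snd[OF this] show ?thesis by simp
qed

lemma has_derivative_lyap_solve:
  fixes R H :: "'a::real_normed_vector \<Rightarrow> real^'n^'n"
  assumes "(R has_derivative R') (at x within U)" "(H has_derivative H') (at x within U)"
    and "R x \<in> PD"
  shows "((\<lambda>y. lyap_solve (R y) (H y)) has_derivative
    (\<lambda>v. lyap_solve (R x) (H' v - (lyap_solve (R x) (H x) ** R' v + R' v ** lyap_solve (R x) (H x)))))
    (at x within U)"
  using has_derivative_compose[OF has_derivative_Pair[OF assms(1,2)]
      has_derivative_lyap_solve_pair[OF assms(3)]] by simp

section \<open>Square roots of positive-definite matrices\<close>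

text \<open>The difference \<open>R - S\<close> of two roots solves the homogeneous Lyapunov equation of \<open>R + S\<close>.\<close>
lemma PD_square_inj:
  fixes R S :: "real^'n^'n"
  assumes "R \<in> PD" "S \<in> PD" "R ** R = S ** S"
  shows "R = S"
proof -
  have "(R - S) ** (R + S) + (R + S) ** (R - S) = 2 *\<^sub>R (R ** R - S ** S)"
    by (simp add: matrix_mult_simps algebra_simps scaleR_2)
  then have "(R - S) ** (R + S) + (R + S) ** (R - S) = 0" using assms(3) by simp
  then have "R - S = 0" by (rule PD_lyapunov_inj[OF PD_add[OF assms(1,2)]])
  then show ?thesis by simp
qed

text \<open>The root is taken in \<open>PD\<close> and not in \<open>SPD\<close> so that it is defined on an open set of matrices, where
  an inverse function theorem applies.\<close>
definition pd_sqrt :: "real^'n^'n \<Rightarrow> real^'n^'n" where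
  "pd_sqrt B = (THE R. R \<in> PD \<and> R ** R = B)"

lemma pd_sqrt_square: "R \<in> PD \<Longrightarrow> pd_sqrt (R ** R) = R"
  unfolding pd_sqrt_def using PD_square_inj by (intro the_equality) auto

text \<open>Differentiating \<open>R ** R = B\<close> gives the Lyapunov equation \<open>R ** H + H ** R = K\<close> for the derivative of the
  root in direction \<open>K\<close>.\<close>
lemma has_derivative_pd_sqrt:
  fixes R :: "real^'n^'n"
  assumes "R \<in> PD"
  shows "(pd_sqrt has_derivative lyap_solve R) (at (R ** R))"
proof (rule has_derivative_inverse_strong[where S = PD and f = "\<lambda>R. R ** R"
      and f' = "\<lambda>H. R ** H + H ** R"])
  show "continuous_on PD (\<lambda>R::real^'n^'n. R ** R)" by (intro continuous_intros)
  show "((\<lambda>R. R ** R) has_derivative (\<lambda>H. R ** H + H ** R)) (at R)"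
    by (auto intro!: derivative_eq_intros)
  show "(\<lambda>H. R ** H + H ** R) \<circ> lyap_solve R = id"
    using lyap_solve_eq[OF assms] by (auto simp: fun_eq_iff add.commute)
qed (use assms open_PD pd_sqrt_square in auto)

lemma SPD_square:
  fixes R :: "real^'n^'n" assumes "R \<in> SPD" shows "R ** R \<in> SPD"
  using SPD_congruence[of "mat 1" R] assms mat_1_in_PD by (simp add: SPD_eq Sym_iff)

lemma convex_SPD: "convex SPD"
  unfolding SPD_eq by (intro convex_Int subspace_imp_convex subspace_Sym convex_PD)

lemma closed_Sym: "closed Sym"
  by (rule closed_subspace[OF subspace_Sym])

text \<open>The size of a root is controlled by its square; this supplies the compactness in the existence
  proof of square roots.\<close>
lemma norm_Sym_square:
  fixes R :: "real^'n^'n" assumes "R \<in> Sym" shows "(norm R)\<^sup>2 = mat 1 \<bullet> (R ** R)"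
proof -
  have "mat 1 \<bullet> (R ** R) = (R ** R) \<bullet> mat 1" by (rule inner_commute)
  also have "\<dots> = R \<bullet> R" using assms by (simp add: inner_matrix_mult_left Sym_iff)
  finally show ?thesis by (simp add: power2_norm_eq_inner)
qed

text \<open>The squares of matrices in \<open>SPD\<close> form an open and closed part of the convex set \<open>SPD\<close>, hence all
  of it. They form an open part because squaring is injective on the open set \<open>PD\<close> (invariance of
  domain), and a root in \<open>PD\<close> of a symmetric matrix is symmetric by uniqueness. They form a closed
  part because roots of a convergent sequence are bounded, and a limit point of the roots is
  semidefinite and injective, hence positive definite.\<close>
lemma SPD_sqrt_exists:
  fixes A :: "real^'n^'n"
  assumes "A \<in> SPD"
  shows "\<exists>R\<in>SPD. R ** R = A"
proof -
  let ?T = "(\<lambda>R::real^'n^'n. R ** R) ` SPD"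
  have sub: "?T \<subseteq> SPD" using SPD_square by blast
  have img: "?T = Sym \<inter> (\<lambda>R::real^'n^'n. R ** R) ` PD"
  proof
    show "?T \<subseteq> Sym \<inter> (\<lambda>R. R ** R) ` PD" using sub by (auto simp: SPD_eq)
    show "Sym \<inter> (\<lambda>R. R ** R) ` PD \<subseteq> ?T"
    proof clarify
      fix R :: "real^'n^'n" assume R: "R ** R \<in> Sym" "R \<in> PD"
      then have "transpose R ** transpose R = R ** R" by (simp add: Sym_iff matrix_transpose_mul)
      then have "transpose R = R" using PD_square_inj R(2) PD_transpose by blast
      then show "R ** R \<in> ?T" using R(2) by (auto simp: SPD_eq Sym_iff)
    qed
  qed
  have "open ((\<lambda>R::real^'n^'n. R ** R) ` PD)"
    by (rule invariance_of_domain)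
      (auto intro!: continuous_intros open_PD inj_onI dest: PD_square_inj)
  then have 1: "openin (top_of_set SPD) ?T"
    using img sub by (auto simp: openin_open SPD_eq)
  have 2: "closedin (top_of_set SPD) ?T"
    unfolding closedin_limpt
  proof (intro conjI sub allI impI)
    fix B :: "real^'n^'n" assume B: "B islimpt ?T \<and> B \<in> SPD"
    then obtain b where b: "\<And>n. b n \<in> ?T" "b \<longlonglongrightarrow> B" by (auto simp: islimpt_sequential)
    then obtain r where r: "\<And>n. r n \<in> SPD" "\<And>n. r n ** r n = b n"
      unfolding image_iff by metis
    have "(\<lambda>n. mat 1 \<bullet> b n) \<longlonglongrightarrow> mat 1 \<bullet> B" by (intro tendsto_intros b)
    then have "Bseq (\<lambda>n. mat 1 \<bullet> b n)" by (rule convergentI[THEN convergent_imp_Bseq])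
    then obtain K where K: "\<And>n. mat 1 \<bullet> b n \<le> K" "0 < K"
      unfolding Bseq_def by (metis abs_le_D1 real_norm_def)
    have "norm (r n) \<le> sqrt K" for n
      using norm_Sym_square[of "r n"] r K by (intro real_le_rsqrt) (auto simp: SPD_eq)
    then have "bounded (range r)" unfolding bounded_iff by blast
    then obtain R s where s: "strict_mono s" "(r \<circ> s) \<longlonglongrightarrow> R"
      using bounded_imp_convergent_subsequence by blast
    have sq: "R ** R = B"
    proof (rule LIMSEQ_unique)
      show "(\<lambda>n. (r \<circ> s) n ** (r \<circ> s) n) \<longlonglongrightarrow> R ** R"
        by (intro bounded_bilinear.tendsto[OF bounded_bilinear_matrix_mult] s)
      show "(\<lambda>n. (r \<circ> s) n ** (r \<circ> s) n) \<longlonglongrightarrow> B"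
        using LIMSEQ_subseq_LIMSEQ[OF b(2) s(1)] r(2) by (simp add: o_def)
    qed
    have "R \<in> SPD"
    proof (rule SPD_of_nonneg)
      show "R \<in> Sym"
        using closed_Sym s(2) r(1) closed_sequentially[of Sym "r \<circ> s" R] by (auto simp: SPD_eq)
      show "0 \<le> x \<bullet> (R *v x)" for x
      proof (rule LIMSEQ_le_const)
        show "(\<lambda>n. x \<bullet> ((r \<circ> s) n *v x)) \<longlonglongrightarrow> x \<bullet> (R *v x)"
          by (intro tendsto_intros bounded_bilinear.tendsto[OF bounded_bilinear_matrix_vector_mult] s)
        have "0 \<le> x \<bullet> (r n *v x)" for n
          using r(1)[of n] by (cases "x = 0") (auto simp: SPD_def less_imp_le)
        then show "\<exists>N. \<forall>n\<ge>N. 0 \<le> x \<bullet> ((r \<circ> s) n *v x)" by auto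
      qed
      fix x assume "R *v x = 0"
      then have "R *v (R *v x) = 0" by (simp add: matrix_vector_mult_0_right)
      then have "B *v x = 0" using sq by (simp add: matrix_vector_mul_assoc)
      then show "x = 0" using B PD_nullspace by (auto simp: SPD_eq)
    qed
    then show "B \<in> ?T" using sq by blast
  qed
  have "mat 1 \<in> ?T" using mat_1_in_PD by (auto simp: SPD_eq Sym_iff image_iff intro!: bexI[of _ "mat 1"])
  then have "?T = SPD"
    using convex_connected[OF convex_SPD] 1 2 unfolding connected_clopen by blast
  with assms have "A \<in> ?T" by simp
  then show ?thesis by (metis (no_types, lifting) imageE)
qed

lemma pd_sqrt:
  assumes "A \<in> SPD"
  shows pd_sqrt_in_SPD: "pd_sqrt A \<in> SPD" and pd_sqrt_mult_self: "pd_sqrt A ** pd_sqrt A = A"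
proof -
  obtain R where R: "R \<in> SPD" "R ** R = A" using SPD_sqrt_exists[OF assms] by blast
  then have "pd_sqrt A = R" using pd_sqrt_square[of R] by (auto simp: SPD_eq)
  then show "pd_sqrt A \<in> SPD" "pd_sqrt A ** pd_sqrt A = A" using R by auto
qed

lemma spd_sqrt_unique:
  fixes R :: "real^'n^'n"
  assumes "R \<in> SPD" "R ** R = A" shows "spd_sqrt A = R"
  unfolding spd_sqrt_def using assms PD_square_inj[of _ R]
  by (intro the_equality) (auto simp: SPD_eq)

lemma spd_sqrt_eq_pd_sqrt: "A \<in> SPD \<Longrightarrow> spd_sqrt A = pd_sqrt A"
  by (intro spd_sqrt_unique pd_sqrt_in_SPD pd_sqrt_mult_self)

lemma spd_sqrt:
  assumes "A \<in> SPD"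
  shows spd_sqrt_in_SPD: "spd_sqrt A \<in> SPD" and spd_sqrt_mult_self: "spd_sqrt A ** spd_sqrt A = A"
  using pd_sqrt[OF assms] spd_sqrt_eq_pd_sqrt[OF assms] by auto

section \<open>Closure properties of \<open>C\<^sup>k\<close> maps\<close>

text \<open>\<open>Ck_on\<close> asks for directional derivatives that are again \<open>C\<^sup>k\<close>. Each closure property below is
  proved by induction on \<open>k\<close>: the derivative of the new map is an expression of the same kind in maps
  that are \<open>C\<^sup>k\<close> already.\<close>
lemma Ck_on_cong:
  assumes "Ck_on k S U f" "\<And>x. x \<in> U \<Longrightarrow> f x = g x"
  shows "Ck_on k S U g"
proof (cases k)
  case 0 then show ?thesis using assms continuous_on_cong[of U U f g] by simp
next
  case (Suc m)
  then show ?thesis using assms has_derivative_transform[of _ U g f] by fastforce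
qed

lemma Ck_on_continuous: "Ck_on k S U f \<Longrightarrow> continuous_on U f"
  by (cases k) (auto simp: continuous_on_eq_continuous_within intro: has_derivative_continuous)

lemma Ck_on_Suc_imp: "Ck_on (Suc k) S U f \<Longrightarrow> Ck_on k S U f"
proof (induction k arbitrary: f)
  case 0 then show ?case using Ck_on_continuous by fastforce
next
  case (Suc k)
  then obtain f' where f': "\<forall>x\<in>U. (f has_derivative f' x) (at x within U)"
    "\<forall>v\<in>S. Ck_on (Suc k) S U (\<lambda>x. f' x v)" unfolding Ck_on.simps(2)[of "Suc k"] by blast
  then show ?case using Suc.IH by auto
qed

lemma Ck_on_const: "Ck_on k S U (\<lambda>x. c)"
proof (induction k arbitrary: c)
  case (Suc k) then show ?case by (auto intro!: exI[of _ "\<lambda>x v. 0"])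
qed simp

lemma Ck_on_bounded_linear:
  assumes "bounded_linear l" shows "Ck_on k S U l"
proof (cases k)
  case 0 then show ?thesis using linear_continuous_on[OF assms] by simp
next
  case (Suc m)
  then show ?thesis
    by (auto intro!: exI[of _ "\<lambda>x. l"] bounded_linear_imp_has_derivative assms Ck_on_const)
qed

lemma Ck_on_linear_image:
  assumes "bounded_linear l"
  shows "Ck_on k S U f \<Longrightarrow> Ck_on k S U (\<lambda>x. l (f x))"
proof (induction k arbitrary: f)
  case 0
  then show ?case using bounded_linear.continuous_on[OF assms] by auto
next
  case (Suc k)
  then obtain f' where f': "\<And>x. x\<in>U \<Longrightarrow> (f has_derivative f' x) (at x within U)"
    "\<And>v. v\<in>S \<Longrightarrow> Ck_on k S U (\<lambda>x. f' x v)" by auto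
  show ?case unfolding Ck_on.simps
    by (intro exI[of _ "\<lambda>x v. l (f' x v)"] conjI ballI Suc.IH f'
        bounded_linear.has_derivative[OF assms f'(1)])
qed

lemma Ck_on_add:
  "Ck_on k S U f \<Longrightarrow> Ck_on k S U g \<Longrightarrow> Ck_on k S U (\<lambda>x. f x + g x)"
proof (induction k arbitrary: f g)
  case 0 then show ?case by (auto intro: continuous_intros)
next
  case (Suc k)
  obtain f' where f': "\<And>x. x\<in>U \<Longrightarrow> (f has_derivative f' x) (at x within U)"
    "\<And>v. v\<in>S \<Longrightarrow> Ck_on k S U (\<lambda>x. f' x v)" using Suc.prems(1) by auto
  obtain g' where g': "\<And>x. x\<in>U \<Longrightarrow> (g has_derivative g' x) (at x within U)"
    "\<And>v. v\<in>S \<Longrightarrow> Ck_on k S U (\<lambda>x. g' x v)" using Suc.prems(2) by auto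
  show ?case unfolding Ck_on.simps
    by (intro exI[of _ "\<lambda>x v. f' x v + g' x v"] conjI ballI Suc.IH f' g' has_derivative_add)
qed

lemma Ck_on_diff:
  "Ck_on k S U f \<Longrightarrow> Ck_on k S U g \<Longrightarrow> Ck_on k S U (\<lambda>x. f x - g x)"
  using Ck_on_add[of k S U f "\<lambda>x. - g x"]
    Ck_on_linear_image[OF bounded_linear_minus[OF bounded_linear_ident], of k S U g] by simp

lemma Ck_on_bilinear:
  assumes "bounded_bilinear b"
  shows "Ck_on k S U f \<Longrightarrow> Ck_on k S U g \<Longrightarrow> Ck_on k S U (\<lambda>x. b (f x) (g x))"
proof (induction k arbitrary: f g)
  case 0 then show ?case using bounded_bilinear.continuous_on[OF assms] by auto
next
  case (Suc k)
  obtain f' where f': "\<And>x. x\<in>U \<Longrightarrow> (f has_derivative f' x) (at x within U)"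
    "\<And>v. v\<in>S \<Longrightarrow> Ck_on k S U (\<lambda>x. f' x v)" using Suc.prems(1) by auto
  obtain g' where g': "\<And>x. x\<in>U \<Longrightarrow> (g has_derivative g' x) (at x within U)"
    "\<And>v. v\<in>S \<Longrightarrow> Ck_on k S U (\<lambda>x. g' x v)" using Suc.prems(2) by auto
  have k: "Ck_on k S U f" "Ck_on k S U g" using Suc.prems Ck_on_Suc_imp by blast+
  show ?case unfolding Ck_on.simps
    by (intro exI[of _ "\<lambda>x v. b (f x) (g' x v) + b (f' x v) (g x)"] conjI ballI
        bounded_bilinear.FDERIV[OF assms] f' g' Ck_on_add Suc.IH k)
qed

lemmas Ck_on_matrix_mult = Ck_on_bilinear[OF bounded_bilinear_matrix_mult]

text \<open>The derivative of \<open>X = lyap_solve R H\<close> in direction \<open>v\<close> is \<open>lyap_solve R\<close> of an expression in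
  \<open>X\<close>, \<open>R' v\<close> and \<open>H' v\<close>, so the induction hypothesis is used twice, for \<open>X\<close> and for the new
  right-hand side.\<close>
lemma Ck_on_lyap_solve:
  fixes R H :: "'a::euclidean_space \<Rightarrow> real^'n^'n"
  assumes "\<And>x. x \<in> U \<Longrightarrow> R x \<in> PD"
  shows "Ck_on k S U R \<Longrightarrow> Ck_on k S U H \<Longrightarrow> Ck_on k S U (\<lambda>x. lyap_solve (R x) (H x))"
proof (induction k arbitrary: H)
  case 0
  show ?case unfolding Ck_on.simps continuous_on_def
  proof
    fix x assume x: "x \<in> U"
    have "((\<lambda>x. (R x, H x)) \<longlongrightarrow> (R x, H x)) (at x within U)"
      using 0 x by (intro tendsto_Pair) (auto simp: continuous_on_def)
    from isCont_tendsto_compose[OF has_derivative_continuous[OF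
          has_derivative_lyap_solve_pair[OF assms[OF x], of "H x"]] this]
    show "((\<lambda>x. lyap_solve (R x) (H x)) \<longlongrightarrow> lyap_solve (R x) (H x)) (at x within U)" by simp
  qed
next
  case (Suc k)
  obtain R' where R': "\<And>x. x\<in>U \<Longrightarrow> (R has_derivative R' x) (at x within U)"
    "\<And>v. v\<in>S \<Longrightarrow> Ck_on k S U (\<lambda>x. R' x v)" using Suc.prems(1) by auto
  obtain H' where H': "\<And>x. x\<in>U \<Longrightarrow> (H has_derivative H' x) (at x within U)"
    "\<And>v. v\<in>S \<Longrightarrow> Ck_on k S U (\<lambda>x. H' x v)" using Suc.prems(2) by auto
  have k: "Ck_on k S U R" "Ck_on k S U H" using Suc.prems Ck_on_Suc_imp by blast+
  let ?X = "\<lambda>x. lyap_solve (R x) (H x)"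
  show ?case unfolding Ck_on.simps
    by (intro exI[of _ "\<lambda>x v. lyap_solve (R x) (H' x v - (?X x ** R' x v + R' x v ** ?X x))"]
        conjI ballI has_derivative_lyap_solve R' H' assms Suc.IH k Ck_on_diff Ck_on_add
        Ck_on_matrix_mult)
qed

text \<open>The derivative of the root is \<open>lyap_solve\<close> at the root itself, so each order of smoothness of
  the root yields the next one, as far as \<open>A\<close> itself is smooth.\<close>
lemma Ck_on_spd_sqrt:
  fixes A :: "'a::euclidean_space \<Rightarrow> real^'n^'n"
  assumes A: "\<And>x. x \<in> U \<Longrightarrow> A x \<in> SPD"
  shows "Ck_on k S U A \<Longrightarrow> Ck_on k S U (\<lambda>x. spd_sqrt (A x))"
proof (induction k)
  case 0
  show ?case unfolding Ck_on.simps continuous_on_def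
  proof
    fix x assume x: "x \<in> U"
    have "isCont pd_sqrt (A x)"
      using has_derivative_continuous[OF has_derivative_pd_sqrt[of "pd_sqrt (A x)"]]
        pd_sqrt[OF A[OF x]] by (simp add: SPD_eq)
    moreover have "(A \<longlongrightarrow> A x) (at x within U)" using 0 x by (simp add: continuous_on_def)
    ultimately have "((\<lambda>x. pd_sqrt (A x)) \<longlongrightarrow> pd_sqrt (A x)) (at x within U)"
      by (rule isCont_tendsto_compose)
    then show "((\<lambda>x. spd_sqrt (A x)) \<longlongrightarrow> spd_sqrt (A x)) (at x within U)"
      using x by (subst Lim_cong_within[where g = "\<lambda>x. pd_sqrt (A x)"])
        (auto simp: spd_sqrt_eq_pd_sqrt A)
  qed
next
  case (Suc k)
  obtain A' where A': "\<And>x. x\<in>U \<Longrightarrow> (A has_derivative A' x) (at x within U)"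
    "\<And>v. v\<in>S \<Longrightarrow> Ck_on k S U (\<lambda>x. A' x v)" using Suc.prems(1) by auto
  have k: "Ck_on k S U (\<lambda>x. spd_sqrt (A x))" using Suc Ck_on_Suc_imp by blast
  show ?case unfolding Ck_on.simps
  proof (intro exI[of _ "\<lambda>x v. lyap_solve (spd_sqrt (A x)) (A' x v)"] conjI ballI
      Ck_on_lyap_solve k A')
    show "spd_sqrt (A x) \<in> PD" if "x \<in> U" for x using spd_sqrt_in_SPD A that by (auto simp: SPD_eq)
    fix x assume x: "x \<in> U"
    have "(pd_sqrt has_derivative lyap_solve (spd_sqrt (A x))) (at (A x))"
      using has_derivative_pd_sqrt[of "spd_sqrt (A x)"] spd_sqrt[OF A[OF x]] by (simp add: SPD_eq)
    from has_derivative_compose[OF A'(1)[OF x] this]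
    show "((\<lambda>x. spd_sqrt (A x)) has_derivative (\<lambda>v. lyap_solve (spd_sqrt (A x)) (A' x v)))
       (at x within U)"
      by (rule has_derivative_transform[rotated 2]) (auto simp: x A spd_sqrt_eq_pd_sqrt)
  qed
qed

section \<open>The Levi-Civita connection of the Wasserstein metric\<close>

lemma SPD_D: assumes "A \<in> SPD" shows "A \<in> PD" "A \<in> Sym" "transpose A = A"
  using assms by (auto simp: SPD_eq Sym_iff)

text \<open>In this form \<open>p\<close> enters the metric only through \<open>lyap_solve p u\<close>, whose derivative is known.\<close>
lemma wasserstein_eq_inner:
  fixes p u v :: "real^'n^'n"
  assumes "p \<in> SPD" "u \<in> Sym" "v \<in> Sym"
  shows "wasserstein p u v = (lyap_solve p u \<bullet> v) / 2"
proof -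
  let ?X = "lyap_solve p u" and ?Y = "lyap_solve p v"
  have X: "transpose ?X = ?X" and Y: "transpose ?Y = ?Y"
    using lyap_solve_Sym[OF assms(1,2)] lyap_solve_Sym[OF assms(1,3)] by (simp_all add: Sym_iff)
  have p: "transpose p = p" "p \<in> PD" using assms by (auto dest: SPD_D)
  have "wasserstein p u v = (p ** ?X) \<bullet> ?Y"
    by (simp add: wasserstein_def trace_matrix_mult_eq_inner transpose_simps X p lyap_eq_lyap_solve assms)
  moreover have "(?X ** p) \<bullet> ?Y = (p ** ?X) \<bullet> ?Y"
    using inner_transpose_transpose[of "?X ** p" ?Y] by (simp add: transpose_simps X Y p)
  moreover have "?X \<bullet> v = ?X \<bullet> (?Y ** p + p ** ?Y)" by (simp add: lyap_solve_eq p)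
  moreover have "?X \<bullet> (?Y ** p) = (?X ** p) \<bullet> ?Y"
    by (simp add: inner_matrix_mult_right p)
  moreover have "?X \<bullet> (p ** ?Y) = (p ** ?X) \<bullet> ?Y"
    by (simp add: inner_matrix_mult_left p)
  ultimately show ?thesis by (simp add: inner_add_right)
qed

lemma metric_deriv_wasserstein:
  fixes p z u v :: "real^'n^'n"
  assumes p: "p \<in> SPD" and z: "z \<in> Sym" and u: "u \<in> Sym" and v: "v \<in> Sym"
  shows "metric_deriv wasserstein p z u v = - ((lyap_solve p u ** z) \<bullet> lyap_solve p v)"
  unfolding metric_deriv_def
proof (rule DERIV_imp_deriv)
  let ?X = "lyap_solve p u" and ?Y = "lyap_solve p v"
  have X: "transpose ?X = ?X" and Y: "transpose ?Y = ?Y" and z': "transpose z = z"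
    using lyap_solve_Sym[OF p u] lyap_solve_Sym[OF p v] z by (simp_all add: Sym_iff)
  have P: "p \<in> PD" using p by (rule SPD_D)
  have lin: "linear (lyap_solve p)"
    using bounded_linear_lyap_solve[OF P] by (rule bounded_linear.linear)
  have "((\<lambda>t. (lyap_solve (p + t *\<^sub>R z) u \<bullet> v) / 2) has_derivative
      (\<lambda>t. (lyap_solve (p + 0 *\<^sub>R z) (0 - (lyap_solve (p + 0 *\<^sub>R z) u ** (t *\<^sub>R z) + (t *\<^sub>R z) ** lyap_solve (p + 0 *\<^sub>R z) u)) \<bullet> v) / 2)) (at 0)"
    by (rule bounded_linear.has_derivative[OF bounded_linear_divide has_derivative_inner_left[OF has_derivative_lyap_solve]])
      (auto intro!: derivative_eq_intros P)
  then have D0: "((\<lambda>t. (lyap_solve (p + t *\<^sub>R z) u \<bullet> v) / 2) has_derivative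
      (\<lambda>t. (lyap_solve p (0 - (?X ** (t *\<^sub>R z) + (t *\<^sub>R z) ** ?X)) \<bullet> v) / 2)) (at 0)"
    by (simp only: scaleR_zero_left add_0_right)
  have D1: "(\<lambda>t. (lyap_solve p (0 - (?X ** (t *\<^sub>R z) + (t *\<^sub>R z) ** ?X)) \<bullet> v) / 2)
      = (*) (- ((?X ** z) \<bullet> ?Y))"
  proof
    fix t
    have "0 - (?X ** (t *\<^sub>R z) + (t *\<^sub>R z) ** ?X) = (- t) *\<^sub>R (?X ** z + z ** ?X)"
      by (simp add: matrix_mult_simps algebra_simps)
    then have "lyap_solve p (0 - (?X ** (t *\<^sub>R z) + (t *\<^sub>R z) ** ?X)) \<bullet> v
        = - t * ((?X ** z + z ** ?X) \<bullet> ?Y)"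
      by (simp add: linear_cmul[OF lin] linear_neg[OF lin] lyap_solve_adjoint[OF p])
    moreover have "(z ** ?X) \<bullet> ?Y = (?X ** z) \<bullet> ?Y"
      using inner_transpose_transpose[of "z ** ?X" ?Y] by (simp add: transpose_simps X Y z')
    ultimately show "(lyap_solve p (0 - (?X ** (t *\<^sub>R z) + (t *\<^sub>R z) ** ?X)) \<bullet> v) / 2
        = - ((?X ** z) \<bullet> ?Y) * t" by (simp add: inner_add_left)
  qed
  have D: "((\<lambda>t. (lyap_solve (p + t *\<^sub>R z) u \<bullet> v) / 2)
      has_field_derivative - ((?X ** z) \<bullet> ?Y)) (at 0)"
    using D0 unfolding D1 has_field_derivative_def .
  have "open ((\<lambda>t::real. p + t *\<^sub>R z) -` PD)"
    by (intro continuous_open_vimage open_PD) (intro continuous_intros)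
  moreover have "0 \<in> (\<lambda>t::real. p + t *\<^sub>R z) -` PD" using P by simp
  ultimately show "((\<lambda>t. wasserstein (p + t *\<^sub>R z) u v)
      has_field_derivative - ((?X ** z) \<bullet> ?Y)) (at 0)"
  proof (rule has_field_derivative_transform_within_open[OF D])
    fix t assume "t \<in> (\<lambda>t::real. p + t *\<^sub>R z) -` PD"
    then have "p + t *\<^sub>R z \<in> SPD" using p z by (auto simp: SPD_eq intro: Sym_add Sym_scaleR)
    then show "(lyap_solve (p + t *\<^sub>R z) u \<bullet> v) / 2 = wasserstein (p + t *\<^sub>R z) u v"
      by (simp add: wasserstein_eq_inner u v)
  qed
qed

lemma wasserstein_nondegenerate:
  fixes p u v :: "real^'n^'n"
  assumes p: "p \<in> SPD" and u: "u \<in> Sym" and v: "v \<in> Sym"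
    and eq: "\<And>x. x \<in> Sym \<Longrightarrow> wasserstein p u x = wasserstein p v x"
  shows "u = v"
proof -
  have P: "p \<in> PD" using p by (rule SPD_D)
  have *: "lyap_solve p u \<bullet> x = lyap_solve p v \<bullet> x" if "x \<in> Sym" for x
    using eq[OF that] that by (simp add: wasserstein_eq_inner p u v)
  let ?d = "lyap_solve p u - lyap_solve p v"
  have "?d \<in> Sym" by (intro Sym_diff lyap_solve_Sym p u v)
  then have "?d \<bullet> ?d = 0" using * by (simp add: inner_diff_left)
  then have L: "lyap_solve p u = lyap_solve p v" by simp
  have "u = lyap_solve p u ** p + p ** lyap_solve p u" by (rule lyap_solve_eq[OF P, symmetric])
  also have "\<dots> = v" unfolding L by (rule lyap_solve_eq[OF P])
  finally show ?thesis .
qed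

text \<open>The Levi-Civita connection on the diagonal, which is all that the geodesic equation uses. With
  \<open>U = lyap_solve p u\<close> and \<open>X = lyap_solve p x\<close>, the Koszul expression is
  \<open>- (U ** u) \<bullet> X + ((U ** x) \<bullet> U) / 2\<close>. Substituting \<open>u = U ** p + p ** U\<close> and
  \<open>x = X ** p + p ** X\<close>, the terms with \<open>U ** U ** p\<close> cancel and \<open>- (U ** p ** U) \<bullet> X\<close> remains. So the
  geodesic equation is \<open>\<gamma>'' = 2 U \<gamma> U\<close> with \<open>U = lyap_solve \<gamma> \<gamma>'\<close>.\<close>
lemma christoffel_wasserstein:
  fixes p u :: "real^'n^'n"
  assumes p: "p \<in> SPD" and u: "u \<in> Sym"
  defines "U \<equiv> lyap_solve p u"
  shows "christoffel Sym wasserstein p u u = - (2 *\<^sub>R (U ** p ** U))"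
proof -
  have P: "p \<in> PD" "transpose p = p" using p by (auto dest: SPD_D)
  have U: "transpose U = U" using lyap_solve_Sym[OF p u] by (simp add: U_def Sym_iff)
  let ?w = "- (2 *\<^sub>R (U ** p ** U))"
  have w: "?w \<in> Sym" by (simp add: Sym_iff transpose_simps matrix_mult_simps U P)
  have u_eq: "u = U ** p + p ** U" unfolding U_def by (simp add: lyap_solve_eq P)
  have koszul: "wasserstein p ?w x = (metric_deriv wasserstein p u u x + metric_deriv wasserstein p u u x
      - metric_deriv wasserstein p x u u) / 2" if x: "x \<in> Sym" for x
  proof -
    let ?X = "lyap_solve p x"
    have X: "transpose ?X = ?X" using lyap_solve_Sym[OF p x] by (simp add: Sym_iff)
    have x_eq: "x = ?X ** p + p ** ?X" by (simp add: lyap_solve_eq P)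
    have "wasserstein p ?w x = - ((U ** p ** U) \<bullet> ?X)"
      using lyap_solve_adjoint[OF p, of ?w x] by (simp add: wasserstein_eq_inner p w x)
    moreover have "(U ** u) \<bullet> ?X = (U ** U ** p) \<bullet> ?X + (U ** p ** U) \<bullet> ?X"
      by (subst u_eq) (simp add: matrix_mult_simps inner_add_left)
    moreover have "(U ** x) \<bullet> U = 2 * ((U ** U ** p) \<bullet> ?X)"
    proof -
      have "(U ** x) \<bullet> U = x \<bullet> (U ** U)" using inner_matrix_mult_left[of U x U] U by simp
      also have "\<dots> = (?X ** p) \<bullet> (U ** U) + (p ** ?X) \<bullet> (U ** U)"
        by (subst x_eq) (simp add: inner_add_left)
      also have "(?X ** p) \<bullet> (U ** U) = ?X \<bullet> (U ** U ** p)"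
        using inner_matrix_mult_right[of ?X p "U ** U"] P by simp
      also have "(p ** ?X) \<bullet> (U ** U) = ?X \<bullet> (U ** U ** p)"
        using inner_transpose_transpose[of "p ** ?X" "U ** U"] inner_matrix_mult_right[of ?X p "U ** U"] P
        by (simp add: transpose_simps U X)
      finally show ?thesis by (simp add: inner_commute)
    qed
    ultimately show ?thesis
      by (simp add: metric_deriv_wasserstein p u x flip: U_def)
  qed
  show ?thesis unfolding christoffel_def
  proof (rule the_equality)
    show "?w \<in> Sym \<and> (\<forall>x\<in>Sym. wasserstein p ?w x = (metric_deriv wasserstein p u u x
       + metric_deriv wasserstein p u u x - metric_deriv wasserstein p x u u) / 2)"
      using w koszul by blast
    fix w' assume "w' \<in> Sym \<and> (\<forall>x\<in>Sym. wasserstein p w' x = (metric_deriv wasserstein p u u x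
       + metric_deriv wasserstein p u u x - metric_deriv wasserstein p x u u) / 2)"
    then have w': "w' \<in> Sym" and eq: "\<And>x. x \<in> Sym \<Longrightarrow> wasserstein p w' x = wasserstein p ?w x"
      by (simp_all only: koszul)
    from eq show "w' = ?w" by (rule wasserstein_nondegenerate[OF p w' w])
  qed
qed

section \<open>The exponential and logarithm are inverse diffeomorphisms\<close>

lemma wExp_eq:
  fixes C V :: "real^'n^'n"
  assumes "C \<in> SPD" "V \<in> Sym"
  shows "wExp C V = (mat 1 + lyap_solve C V) ** C ** (mat 1 + lyap_solve C V)"
proof -
  have "(mat 1 + lyap_solve C V) ** C ** (mat 1 + lyap_solve C V)
    = C + (lyap_solve C V ** C + C ** lyap_solve C V) + lyap_solve C V ** C ** lyap_solve C V"
    by (simp add: matrix_mult_simps algebra_simps)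
  then show ?thesis using assms by (simp add: wExp_def lyap_eq_lyap_solve lyap_solve_eq SPD_D)
qed

lemma lyap_solve_scaleR:
  fixes C :: "real^'n^'n"
  shows "C \<in> PD \<Longrightarrow> lyap_solve C (t *\<^sub>R V) = t *\<^sub>R lyap_solve C V"
  using linear_cmul[OF bounded_linear.linear[OF bounded_linear_lyap_solve]] .

lemma lyap_solve_add:
  fixes C :: "real^'n^'n"
  shows "C \<in> PD \<Longrightarrow> lyap_solve C (V + W) = lyap_solve C V + lyap_solve C W"
  using linear_add[OF bounded_linear.linear[OF bounded_linear_lyap_solve]] .

lemma exp_domain_eq:
  "C \<in> SPD \<Longrightarrow> exp_domain C = Sym \<inter> (\<lambda>V. mat 1 + lyap_solve C V) -` SPD"
  by (auto simp: exp_domain_def lyap_eq_lyap_solve)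

lemma mat_1_in_Sym: "mat 1 \<in> Sym" by (simp add: Sym_iff)

lemma openin_SPD: "openin (top_of_set Sym) SPD"
  unfolding SPD_eq using open_PD by (auto simp: openin_open)

lemma openin_exp_domain:
  fixes C :: "real^'n^'n"
  assumes "C \<in> SPD" shows "openin (top_of_set Sym) (exp_domain C)"
proof -
  have "exp_domain C = Sym \<inter> (\<lambda>V. mat 1 + lyap_solve C V) -` PD"
    using lyap_solve_Sym[OF assms] mat_1_in_Sym Sym_add
    by (auto simp: exp_domain_eq[OF assms] SPD_eq)
  moreover have "open ((\<lambda>V. mat 1 + lyap_solve C V) -` PD)"
    by (intro continuous_open_vimage open_PD continuous_intros linear_continuous_on
        bounded_linear_lyap_solve SPD_D assms)
  ultimately show ?thesis by (auto simp: openin_open)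
qed

text \<open>Conjugation by the root of \<open>A\<close> turns the Riccati equation \<open>T ** A ** T = B\<close> into the equation that
  defines a square root.\<close>
lemma prod_sqrt_eq:
  fixes A B T :: "real^'n^'n"
  assumes A: "A \<in> SPD" and T: "T \<in> SPD" and B: "T ** A ** T = B"
  shows "prod_sqrt A B = A ** T"
proof -
  let ?Q = "spd_sqrt A"
  have Q: "?Q \<in> SPD" "?Q ** ?Q = A" using spd_sqrt[OF A] by auto
  have "spd_sqrt (?Q ** B ** ?Q) = ?Q ** T ** ?Q"
  proof (rule spd_sqrt_unique[OF SPD_congruence[OF T Q(1)]])
    have "?Q ** T ** ?Q ** (?Q ** T ** ?Q) = ?Q ** T ** (?Q ** ?Q) ** T ** ?Q"
      by (simp only: matrix_mul_assoc)
    also have "\<dots> = ?Q ** (T ** A ** T) ** ?Q" by (simp only: Q matrix_mul_assoc)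
    finally show "?Q ** T ** ?Q ** (?Q ** T ** ?Q) = ?Q ** B ** ?Q" using B by simp
  qed
  then have "prod_sqrt A B = ?Q ** (?Q ** T ** ?Q) ** matrix_inv ?Q" by (simp add: prod_sqrt_def)
  also have "\<dots> = (?Q ** ?Q) ** T ** (?Q ** matrix_inv ?Q)" by (simp only: matrix_mul_assoc)
  finally show ?thesis using Q PD_inverse[OF SPD_D(1)[OF Q(1)]] by simp
qed

text \<open>The positive-definite solution \<open>T\<close> of \<open>T ** C ** T = B\<close> for \<open>C\<close> and \<open>B\<close> in \<open>SPD\<close>; as a linear
  map it is the optimal transport between the centred Gaussians with covariances \<open>C\<close> and \<open>B\<close>.\<close>
definition riccati_root :: "real^'n^'n \<Rightarrow> real^'n^'n \<Rightarrow> real^'n^'n" where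
  "riccati_root C B =
    matrix_inv (spd_sqrt C) ** spd_sqrt (spd_sqrt C ** B ** spd_sqrt C) ** matrix_inv (spd_sqrt C)"

lemma riccati_root:
  fixes C B :: "real^'n^'n"
  assumes C: "C \<in> SPD" and B: "B \<in> SPD"
  shows riccati_root_in_SPD: "riccati_root C B \<in> SPD"
    and riccati_root_eq: "riccati_root C B ** C ** riccati_root C B = B"
proof -
  let ?Q = "spd_sqrt C" and ?S = "spd_sqrt (spd_sqrt C ** B ** spd_sqrt C)"
  let ?I = "matrix_inv ?Q"
  have Q: "?Q \<in> SPD" "?Q ** ?Q = C" using spd_sqrt[OF C] by auto
  have S: "?S \<in> SPD" "?S ** ?S = ?Q ** B ** ?Q" using spd_sqrt[OF SPD_congruence[OF B Q(1)]] by auto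
  have I: "?I ** ?Q = mat 1" "?Q ** ?I = mat 1" using PD_inverse[OF SPD_D(1)[OF Q(1)]] by auto
  show "riccati_root C B \<in> SPD"
    unfolding riccati_root_def by (intro SPD_congruence SPD_inverse S Q)
  have "riccati_root C B ** C ** riccati_root C B
      = (?I ** ?S ** ?I) ** (?Q ** ?Q) ** (?I ** ?S ** ?I)"
    by (simp only: riccati_root_def Q(2))
  also have "\<dots> = ?I ** ?S ** (?I ** ?Q) ** (?Q ** ?I) ** ?S ** ?I"
    by (simp only: matrix_mul_assoc)
  also have "\<dots> = ?I ** (?S ** ?S) ** ?I" by (simp add: I matrix_mul_assoc)
  also have "\<dots> = (?I ** ?Q) ** B ** (?Q ** ?I)" by (simp only: S matrix_mul_assoc)
  finally show "riccati_root C B ** C ** riccati_root C B = B" by (simp add: I)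
qed

text \<open>Inverting \<open>T ** C ** T = B\<close> gives the Riccati equation with \<open>B\<close> and \<open>C\<close> exchanged, solved by the
  inverse of \<open>T\<close>; so both product roots in \<open>wLog\<close> are expressed through the same \<open>T\<close>.\<close>
lemma wLog_eq:
  fixes C T :: "real^'n^'n"
  assumes C: "C \<in> SPD" and T: "T \<in> SPD"
  shows "wLog C (T ** C ** T) = T ** C + C ** T - 2 *\<^sub>R C"
proof -
  let ?I = "matrix_inv T" and ?B = "T ** C ** T"
  have I: "?I ** T = mat 1" "T ** ?I = mat 1" using PD_inverse[OF SPD_D(1)[OF T]] by auto
  have "?I ** ?B ** ?I = (?I ** T) ** C ** (T ** ?I)" by (simp only: matrix_mul_assoc)
  then have "?I ** ?B ** ?I = C" by (simp add: I)
  then have "prod_sqrt ?B C = ?B ** ?I"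
    by (rule prod_sqrt_eq[OF SPD_congruence[OF C T] SPD_inverse[OF T]])
  also have "\<dots> = T ** C ** (T ** ?I)" by (simp only: matrix_mul_assoc)
  also have "\<dots> = T ** C" by (simp add: I)
  finally show ?thesis using prod_sqrt_eq[OF C T refl] by (simp add: wLog_def)
qed

lemma wLog_wExp:
  fixes C V :: "real^'n^'n"
  assumes C: "C \<in> SPD" and V: "V \<in> exp_domain C"
  shows "wExp C V \<in> SPD" "wLog C (wExp C V) = V"
proof -
  let ?L = "lyap_solve C V"
  have V': "V \<in> Sym" "mat 1 + ?L \<in> SPD" using V by (auto simp: exp_domain_eq[OF C])
  show "wExp C V \<in> SPD" unfolding wExp_eq[OF C V'(1)] by (intro SPD_congruence C V')
  have "wLog C (wExp C V) = (mat 1 + ?L) ** C + C ** (mat 1 + ?L) - 2 *\<^sub>R C"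
    unfolding wExp_eq[OF C V'(1)] by (rule wLog_eq[OF C V'(2)])
  also have "\<dots> = ?L ** C + C ** ?L" by (simp add: matrix_mult_simps scaleR_2)
  finally show "wLog C (wExp C V) = V" by (simp add: lyap_solve_eq SPD_D C)
qed

lemma wLog_eq_riccati_root:
  fixes C B :: "real^'n^'n"
  assumes "C \<in> SPD" "B \<in> SPD"
  shows "wLog C B = riccati_root C B ** C + C ** riccati_root C B - 2 *\<^sub>R C"
  using wLog_eq[OF assms(1) riccati_root_in_SPD[OF assms]] by (simp add: riccati_root_eq[OF assms])

lemma wExp_wLog:
  fixes C B :: "real^'n^'n"
  assumes C: "C \<in> SPD" and B: "B \<in> SPD"
  shows "wLog C B \<in> exp_domain C" "wExp C (wLog C B) = B"
proof -
  let ?T = "riccati_root C B" and ?V = "wLog C B"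
  have T: "?T \<in> SPD" "?T ** C ** ?T = B" using riccati_root[OF C B] by auto
  have V: "?V = (?T - mat 1) ** C + C ** (?T - mat 1)"
    unfolding wLog_eq_riccati_root[OF C B] by (simp add: matrix_mult_simps scaleR_2)
  then have L: "lyap_solve C ?V = ?T - mat 1" by (intro lyap_solve_unique SPD_D C) simp
  have "?V \<in> Sym" unfolding V Sym_iff
    by (simp add: transpose_simps SPD_D(3)[OF C] SPD_D(3)[OF T(1)] add.commute)
  then show "?V \<in> exp_domain C" using T L by (simp add: exp_domain_eq[OF C])
  show "wExp C ?V = B" unfolding wExp_eq[OF C \<open>?V \<in> Sym\<close>] L using T by simp
qed

lemma smooth_on_wExp:
  fixes C :: "real^'n^'n"
  assumes C: "C \<in> SPD" shows "smooth_on Sym (exp_domain C) (wExp C)"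
  unfolding smooth_on_def
proof
  fix k
  have "Ck_on k Sym (exp_domain C) (\<lambda>V. (mat 1 + lyap_solve C V) ** C ** (mat 1 + lyap_solve C V))"
    by (intro Ck_on_matrix_mult Ck_on_add Ck_on_const Ck_on_bounded_linear
        bounded_linear_lyap_solve SPD_D C)
  then show "Ck_on k Sym (exp_domain C) (wExp C)"
    by (rule Ck_on_cong) (simp add: exp_domain_def wExp_eq C)
qed

lemma smooth_on_wLog:
  fixes C :: "real^'n^'n"
  assumes C: "C \<in> SPD" shows "smooth_on Sym SPD (wLog C)"
  unfolding smooth_on_def
proof
  fix k
  have "Ck_on k Sym SPD (\<lambda>B. riccati_root C B)"
    unfolding riccati_root_def
    by (intro Ck_on_matrix_mult Ck_on_const Ck_on_spd_sqrt Ck_on_bounded_linear bounded_linear_ident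
        SPD_congruence spd_sqrt_in_SPD C)
  then have "Ck_on k Sym SPD (\<lambda>B. riccati_root C B ** C + C ** riccati_root C B - 2 *\<^sub>R C)"
    by (intro Ck_on_matrix_mult Ck_on_const Ck_on_add Ck_on_diff)
  then show "Ck_on k Sym SPD (wLog C)"
    by (rule Ck_on_cong) (simp add: wLog_eq_riccati_root C)
qed

lemma diffeomorphism_wExp:
  fixes C :: "real^'n^'n"
  assumes C: "C \<in> SPD" shows "diffeomorphism Sym (exp_domain C) SPD (wExp C) (wLog C)"
  unfolding diffeomorphism_def
proof (intro conjI openin_exp_domain openin_SPD smooth_on_wExp smooth_on_wLog C homeomorphismI)
  show "continuous_on (exp_domain C) (wExp C)" "continuous_on SPD (wLog C)"
    using smooth_on_wExp[OF C] smooth_on_wLog[OF C] Ck_on_continuous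
    unfolding smooth_on_def by blast+
qed (use wLog_wExp[OF C] wExp_wLog[OF C] in auto)

section \<open>Uniqueness for homogeneous linear differential equations\<close>

text \<open>A Gronwall argument: \<open>exp (- 2 * M * s) * (norm (E s))\<^sup>2\<close> is nonincreasing.\<close>
lemma zero_at_one_if_norm_derivative_le:
  fixes E E' :: "real \<Rightarrow> 'a::real_inner"
  assumes E': "\<And>s. s \<in> {0..1} \<Longrightarrow> (E has_vector_derivative E' s) (at s)"
    and le: "\<And>s. s \<in> {0..1} \<Longrightarrow> norm (E' s) \<le> M * norm (E s)"
    and "E 0 = 0"
  shows "E 1 = 0"
proof -
  let ?\<phi> = "\<lambda>s. exp (- (2 * M * s)) * (E s \<bullet> E s)"
  have D: "(?\<phi> has_real_derivative exp (- (2 * M * s)) * (2 * (E s \<bullet> E' s) - 2 * M * (E s \<bullet> E s))) (at s)"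
    if "s \<in> {0..1}" for s
  proof -
    have "((\<lambda>s. E s \<bullet> E s) has_vector_derivative E s \<bullet> E' s + E' s \<bullet> E s) (at s)"
      by (rule bounded_bilinear.has_vector_derivative[OF bounded_bilinear_inner E'[OF that] E'[OF that]])
    then have "((\<lambda>s. E s \<bullet> E s) has_real_derivative 2 * (E s \<bullet> E' s)) (at s)"
      by (simp add: has_real_derivative_iff_has_vector_derivative inner_commute)
    then show ?thesis
      by (auto intro!: derivative_eq_intros simp: algebra_simps)
  qed
  have nonpos: "exp (- (2 * M * s)) * (2 * (E s \<bullet> E' s) - 2 * M * (E s \<bullet> E s)) \<le> 0"
    if "s \<in> {0..1}" for s
  proof -
    have "E s \<bullet> E' s \<le> norm (E s) * norm (E' s)" by (rule norm_cauchy_schwarz)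
    also have "\<dots> \<le> norm (E s) * (M * norm (E s))" using le[OF that] by (intro mult_left_mono) auto
    also have "\<dots> = M * (E s \<bullet> E s)" by (simp add: power2_norm_eq_inner[symmetric] power2_eq_square)
    finally show ?thesis by (intro mult_nonneg_nonpos) auto
  qed
  have "?\<phi> 1 \<le> ?\<phi> 0"
  proof (rule DERIV_nonpos_imp_nonincreasing[where f = ?\<phi>])
    fix s :: real assume "0 \<le> s" "s \<le> 1"
    then show "\<exists>y. (?\<phi> has_real_derivative y) (at s) \<and> y \<le> 0"
      using D[of s] nonpos[of s] by auto
  qed simp
  then have "E 1 \<bullet> E 1 \<le> 0" using \<open>E 0 = 0\<close> by (simp add: mult_le_0_iff)
  then have "E 1 \<bullet> E 1 = 0" using inner_ge_zero[of "E 1"] by linarith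
  then show ?thesis by simp
qed

text \<open>The path \<open>s \<mapsto> s * t\<close> reduces both signs of \<open>t\<close> to the unit interval.\<close>
lemma zero_if_norm_derivative_le:
  fixes E E' :: "real \<Rightarrow> 'a::real_inner"
  assumes J: "is_interval J" "0 \<in> J" "t \<in> J"
    and E': "\<And>s. s \<in> J \<Longrightarrow> (E has_vector_derivative E' s) (at s)"
    and le: "\<And>s. s \<in> J \<Longrightarrow> norm (E' s) \<le> K s * norm (E s)"
    and K: "continuous_on J K" and "E 0 = 0"
  shows "E t = 0"
proof -
  have seg: "s * t \<in> J" if "s \<in> {0..1}" for s
    using convexD_alt[of J 0 t s] J that is_interval_convex[of J] by simp
  have "continuous_on {0..1} (\<lambda>s. K (s * t))"
    by (rule continuous_on_compose2[OF K]) (auto intro!: continuous_intros seg)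
  then have "\<exists>z\<in>{0..1}. \<forall>s\<in>{0..1}. K (s * t) \<le> K (z * t)"
    by (intro continuous_attains_sup) auto
  then obtain z where z: "\<And>s. s \<in> {0..1} \<Longrightarrow> K (s * t) \<le> K (z * t)" by blast
  have "E (1 * t) = 0"
  proof (rule zero_at_one_if_norm_derivative_le[where E = "\<lambda>s. E (s * t)" and E' = "\<lambda>s. t *\<^sub>R E' (s * t)"
        and M = "\<bar>t\<bar> * K (z * t)"])
    fix s :: real assume s: "s \<in> {0..1}"
    have "((\<lambda>s. s * t) has_vector_derivative t) (at s)"
      by (auto intro!: derivative_eq_intros simp flip: has_real_derivative_iff_has_vector_derivative)
    from vector_diff_chain_at[OF this E'[OF seg[OF s]]]
    show "((\<lambda>s. E (s * t)) has_vector_derivative t *\<^sub>R E' (s * t)) (at s)" by (simp add: o_def)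
    have "norm (E' (s * t)) \<le> K (z * t) * norm (E (s * t))"
      by (rule order_trans[OF le[OF seg[OF s]]]) (intro mult_right_mono z s norm_ge_zero)
    then have "\<bar>t\<bar> * norm (E' (s * t)) \<le> \<bar>t\<bar> * (K (z * t) * norm (E (s * t)))"
      by (rule mult_left_mono) simp
    then show "norm (t *\<^sub>R E' (s * t)) \<le> \<bar>t\<bar> * K (z * t) * norm (E (s * t))"
      by (simp add: mult.assoc)
  qed (simp add: \<open>E 0 = 0\<close>)
  then show ?thesis by simp
qed

section \<open>Wasserstein geodesics\<close>

lemma wExp_scaleR_eq:
  fixes C V :: "real^'n^'n"
  assumes "C \<in> SPD" "V \<in> Sym"
  defines "L \<equiv> lyap_solve C V"
  shows "wExp C (t *\<^sub>R V) = C + t *\<^sub>R V + t *\<^sub>R (t *\<^sub>R (L ** C ** L))"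
  using assms
  by (simp add: wExp_def lyap_eq_lyap_solve Sym_scaleR lyap_solve_scaleR SPD_D matrix_mult_simps)

lemma geo_interval_eq:
  fixes C V :: "real^'n^'n"
  assumes "C \<in> SPD" "V \<in> Sym"
  shows "geo_interval C V = (\<lambda>t. mat 1 + t *\<^sub>R lyap_solve C V) -` PD"
  using lyap_solve_Sym[OF assms]
  by (auto simp: geo_interval_def lyap_eq_lyap_solve[OF assms] SPD_eq
      intro: Sym_add Sym_scaleR mat_1_in_Sym)

lemma geo_interval_open_interval:
  fixes C V :: "real^'n^'n"
  assumes "C \<in> SPD" "V \<in> Sym"
  shows "open (geo_interval C V)" "is_interval (geo_interval C V)" "0 \<in> geo_interval C V"
proof -
  let ?P = "\<lambda>t. mat 1 + t *\<^sub>R lyap_solve C V"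
  note eq = geo_interval_eq[OF assms]
  show "open (geo_interval C V)" unfolding eq
    by (intro continuous_open_vimage open_PD continuous_intros)
  show "0 \<in> geo_interval C V" unfolding eq by (simp add: mat_1_in_PD)
  have "convex (?P -` PD)"
    unfolding convex_alt
  proof (intro ballI allI impI)
    fix s t u :: real assume st: "s \<in> ?P -` PD" "t \<in> ?P -` PD" and u: "0 \<le> u \<and> u \<le> 1"
    have "(1 - u) *\<^sub>R ?P s + u *\<^sub>R ?P t \<in> PD"
      using convexD_alt[OF convex_PD, of "?P s" "?P t" u] st u by auto
    moreover have "(1 - u) *\<^sub>R ?P s + u *\<^sub>R ?P t = ?P ((1 - u) *\<^sub>R s + u *\<^sub>R t)"
      by (simp add: algebra_simps)
    ultimately show "(1 - u) *\<^sub>R s + u *\<^sub>R t \<in> ?P -` PD" by simp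
  qed
  then show "is_interval (geo_interval C V)" unfolding eq by (simp add: is_interval_convex_1)
qed

text \<open>Along \<open>\<gamma> = P ** C ** P\<close> with \<open>P = mat 1 + t *\<^sub>R L\<close>, the solution of the Lyapunov equation for
  \<open>\<gamma>'\<close> is \<open>U = L ** matrix_inv P\<close>, because \<open>P\<close> and \<open>L\<close> commute; then
  \<open>U ** \<gamma> ** U = L ** C ** L\<close>, which is half of \<open>\<gamma>''\<close>.\<close>
lemma geodesic_wExp:
  fixes C V :: "real^'n^'n"
  assumes C: "C \<in> SPD" and V: "V \<in> Sym"
  shows "geodesic_on Sym SPD wasserstein (geo_interval C V) (\<lambda>t. wExp C (t *\<^sub>R V))"
proof -
  let ?L = "lyap_solve C V" and ?J = "geo_interval C V"
  let ?M = "?L ** C ** ?L"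
  let ?P = "\<lambda>t. mat 1 + t *\<^sub>R ?L"
  let ?E = "\<lambda>t. wExp C (t *\<^sub>R V)"
  have PC: "C \<in> PD" "transpose C = C" using C by (auto dest: SPD_D)
  have L: "transpose ?L = ?L" using lyap_solve_Sym[OF C V] by (simp add: Sym_iff)
  have Veq: "?L ** C + C ** ?L = V" by (rule lyap_solve_eq[OF PC(1)])
  have E: "?E = (\<lambda>t. C + t *\<^sub>R V + t *\<^sub>R (t *\<^sub>R ?M))"
    by (simp add: wExp_scaleR_eq[OF C V])
  have EP: "?E t = ?P t ** C ** ?P t" for t
    using wExp_eq[OF C Sym_scaleR[OF V], of t] by (simp add: lyap_solve_scaleR PC)
  have P: "?P t \<in> SPD" if "t \<in> ?J" for t
    using that by (simp add: geo_interval_def lyap_eq_lyap_solve C V)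
  have D1: "(?E has_vector_derivative V + (2 * t) *\<^sub>R ?M) (at t)" for t
    unfolding E by (auto intro!: derivative_eq_intros simp: algebra_simps scaleR_2)
  have D1': "(\<lambda>s. vector_derivative ?E (at s)) = (\<lambda>t. V + (2 * t) *\<^sub>R ?M)"
    using vector_derivative_at[OF D1] by blast
  have D2: "((\<lambda>t. V + (2 * t) *\<^sub>R ?M) has_vector_derivative 2 *\<^sub>R ?M) (at t)" for t
    by (auto intro!: derivative_eq_intros)
  have ode: "covariant_deriv_along Sym wasserstein ?E (\<lambda>s. vector_derivative ?E (at s)) t = 0"
    if t: "t \<in> ?J" for t
  proof -
    let ?I = "matrix_inv (?P t)" and ?G = "V + (2 * t) *\<^sub>R ?M"
    let ?U = "?L ** ?I"
    have I: "?I ** ?P t = mat 1" "?P t ** ?I = mat 1" using PD_inverse[OF SPD_D(1)[OF P[OF t]]] by auto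
    have comm: "?P t ** ?L = ?L ** ?P t" by (simp add: matrix_mult_simps)
    have "?I ** ?L = ?I ** (?L ** ?P t) ** ?I" by (simp add: I flip: matrix_mul_assoc)
    also have "\<dots> = ?I ** (?P t ** ?L) ** ?I" by (simp only: comm)
    also have "\<dots> = ?U" by (simp add: I matrix_mul_assoc)
    finally have U2: "?U = ?I ** ?L" ..
    have UP: "?U ** ?P t = ?L" by (simp add: I flip: matrix_mul_assoc)
    have PU: "?P t ** ?U = ?L" by (simp add: U2 I matrix_mul_assoc)
    have UE: "?U ** ?E t = ?L ** C ** ?P t"
      using UP by (simp add: EP matrix_mul_assoc)
    have EU: "?E t ** ?U = ?P t ** C ** ?L"
      using PU by (simp add: EP flip: matrix_mul_assoc)
    have "?U ** ?E t + ?E t ** ?U = (?L ** C + C ** ?L) + (2 * t) *\<^sub>R ?M"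
      unfolding UE EU by (simp add: matrix_mult_simps algebra_simps flip: scaleR_2)
    then have U: "lyap_solve (?E t) ?G = ?U"
      using SPD_congruence[OF C P[OF t]] by (intro lyap_solve_unique) (auto simp: EP Veq dest: SPD_D)
    have "?G \<in> Sym"
      using V by (simp add: Sym_iff transpose_simps L PC matrix_mul_assoc)
    then have "christoffel Sym wasserstein (?E t) ?G ?G = - (2 *\<^sub>R (?U ** ?E t ** ?U))"
      using christoffel_wasserstein[of "?E t" ?G] SPD_congruence[OF C P[OF t]]
      unfolding U by (simp add: EP)
    also have "?U ** ?E t ** ?U = ?M"
      unfolding UE using PU by (simp flip: matrix_mul_assoc)
    finally show ?thesis
      unfolding covariant_deriv_along_def D1' vector_derivative_at[OF D1] vector_derivative_at[OF D2]
      by simp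
  qed
  have "smooth_on UNIV ?J ?E"
    unfolding smooth_on_def E
    by (intro allI Ck_on_add Ck_on_const Ck_on_bilinear[OF bounded_bilinear_scaleR]
        Ck_on_bounded_linear bounded_linear_ident)
  moreover have "?E ` ?J \<subseteq> SPD" using SPD_congruence[OF C P] EP by auto
  ultimately show ?thesis
    unfolding geodesic_on_def using geo_interval_open_interval[OF C V] ode by blast
qed

lemma has_derivative_real_imp_has_vector_derivative:
  fixes f :: "real \<Rightarrow> 'a::real_normed_vector"
  assumes "(f has_derivative f') F"
  shows "(f has_vector_derivative f' 1) F"
proof -
  have "f' h = h *\<^sub>R f' 1" for h
    using linear_cmul[OF has_derivative_linear[OF assms], of h 1] by simp
  then have "f' = (\<lambda>h. h *\<^sub>R f' 1)" by blast
  then show ?thesis using assms by (simp add: has_vector_derivative_def)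
qed

text \<open>On the open set \<open>J\<close> derivatives relative to \<open>J\<close> are two-sided, so smoothness on \<open>J\<close> provides a velocity
  and an acceleration. The velocity is symmetric because transposition fixes \<open>\<gamma>\<close>, which makes the formula
  for the Christoffel symbols applicable.\<close>
lemma geodesic_wasserstein_ode:
  fixes \<gamma> :: "real \<Rightarrow> real^'n^'n"
  assumes geo: "geodesic_on Sym SPD wasserstein J \<gamma>"
  obtains \<gamma>' where
    "\<And>t. t \<in> J \<Longrightarrow> (\<gamma> has_vector_derivative \<gamma>' t) (at t)"
    "\<And>t. t \<in> J \<Longrightarrow> \<gamma>' t \<in> Sym"
    "\<And>t. t \<in> J \<Longrightarrow> (\<gamma>' has_vector_derivative
        2 *\<^sub>R (lyap_solve (\<gamma> t) (\<gamma>' t) ** \<gamma> t ** lyap_solve (\<gamma> t) (\<gamma>' t))) (at t)"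
proof -
  have J: "open J" and SPD: "\<And>t. t \<in> J \<Longrightarrow> \<gamma> t \<in> SPD" and "Ck_on (Suc (Suc 0)) UNIV J \<gamma>"
    and ode: "\<And>t. t \<in> J \<Longrightarrow>
        covariant_deriv_along Sym wasserstein \<gamma> (\<lambda>s. vector_derivative \<gamma> (at s)) t = 0"
    using geo unfolding geodesic_on_def smooth_on_def by blast+
  then obtain f where f: "\<And>t. t \<in> J \<Longrightarrow> (\<gamma> has_derivative f t) (at t within J)"
    and "Ck_on (Suc 0) UNIV J (\<lambda>t. f t 1)"
    unfolding Ck_on.simps(2)[of "Suc 0"] by blast
  then obtain h where h: "\<And>t. t \<in> J \<Longrightarrow> ((\<lambda>t. f t 1) has_derivative h t) (at t within J)"
    unfolding Ck_on.simps(2)[of 0] by blast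
  let ?d = "\<lambda>t. f t 1"
  have d: "(\<gamma> has_vector_derivative ?d t) (at t)" if "t \<in> J" for t
    using has_derivative_real_imp_has_vector_derivative[OF f[OF that]] at_within_open[OF that J] by simp
  have dd: "(?d has_vector_derivative h t 1) (at t)" if "t \<in> J" for t
    using has_derivative_real_imp_has_vector_derivative[OF h[OF that]] at_within_open[OF that J] by simp
  have sym: "?d t \<in> Sym" if t: "t \<in> J" for t
  proof -
    have "((\<lambda>s. transpose (\<gamma> s)) has_vector_derivative transpose (?d t)) (at t)"
      by (rule bounded_linear.has_vector_derivative[OF bounded_linear_transpose d[OF t]])
    then have "(\<gamma> has_vector_derivative transpose (?d t)) (at t)"
      by (rule has_vector_derivative_transform_within_open[OF _ J t]) (use SPD SPD_D in blast)
    then show ?thesis using vector_derivative_unique_at[OF d[OF t]] by (metis Sym_iff)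
  qed
  have "h t 1 = 2 *\<^sub>R (lyap_solve (\<gamma> t) (?d t) ** \<gamma> t ** lyap_solve (\<gamma> t) (?d t))" if t: "t \<in> J" for t
  proof -
    have "((\<lambda>s. vector_derivative \<gamma> (at s)) has_vector_derivative h t 1) (at t)"
      by (rule has_vector_derivative_transform_within_open[OF dd[OF t] J t])
        (use d vector_derivative_at in fastforce)
    then have "vector_derivative (\<lambda>s. vector_derivative \<gamma> (at s)) (at t) = h t 1"
      by (rule vector_derivative_at)
    then show ?thesis
      using ode[OF t] unfolding covariant_deriv_along_def vector_derivative_at[OF d[OF t]]
        christoffel_wasserstein[OF SPD[OF t] sym[OF t]] by simp
  qed
  then show ?thesis using that[of ?d] d sym dd by simp
qed

text \<open>For \<open>U = lyap_solve \<gamma> \<gamma>'\<close>, differentiating \<open>\<gamma>' = U ** \<gamma> + \<gamma> ** U\<close> and inserting the geodesic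
  equation leaves the homogeneous Lyapunov equation for \<open>U' + U ** U\<close>, so \<open>U' = - (U ** U)\<close>. With
  \<open>L = U 0\<close> and \<open>P t = mat 1 + t *\<^sub>R L\<close>, both \<open>P ** U - L\<close> and \<open>\<gamma> - P ** C ** P\<close> solve
  homogeneous linear equations with zero initial value, and so vanish on \<open>J\<close>. Finally \<open>P t\<close> is injective for
  every \<open>t \<in> J\<close>, hence it cannot leave the positive-definite cone while \<open>t\<close> moves in \<open>J\<close>.\<close>
lemma geodesic_eq_wExp:
  fixes \<gamma> :: "real \<Rightarrow> real^'n^'n"
  assumes geo: "geodesic_on Sym SPD wasserstein J \<gamma>" and "0 \<in> J" and "\<gamma> 0 = C"
  shows "\<exists>V\<in>Sym. J \<subseteq> geo_interval C V \<and> (\<forall>t\<in>J. \<gamma> t = wExp C (t *\<^sub>R V))"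
proof -
  have J: "open J" "is_interval J" and SPD: "\<And>t. t \<in> J \<Longrightarrow> \<gamma> t \<in> SPD"
    using geo unfolding geodesic_on_def by blast+
  obtain \<gamma>' where d: "\<And>t. t \<in> J \<Longrightarrow> (\<gamma> has_vector_derivative \<gamma>' t) (at t)"
    and sym: "\<And>t. t \<in> J \<Longrightarrow> \<gamma>' t \<in> Sym"
    and dd: "\<And>t. t \<in> J \<Longrightarrow> (\<gamma>' has_vector_derivative
        2 *\<^sub>R (lyap_solve (\<gamma> t) (\<gamma>' t) ** \<gamma> t ** lyap_solve (\<gamma> t) (\<gamma>' t))) (at t)"
    by (rule geodesic_wasserstein_ode[OF geo]) (rule that)
  define U where "U t = lyap_solve (\<gamma> t) (\<gamma>' t)" for t
  have PD: "\<gamma> t \<in> PD" if "t \<in> J" for t using SPD[OF that] by (rule SPD_D)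
  have U_eq: "U t ** \<gamma> t + \<gamma> t ** U t = \<gamma>' t" if "t \<in> J" for t
    unfolding U_def by (rule lyap_solve_eq[OF PD[OF that]])
  have U_sym: "transpose (U t) = U t" if "t \<in> J" for t
    using lyap_solve_Sym[OF SPD sym] that by (simp add: U_def Sym_iff)
  have dU: "(U has_vector_derivative - (U t ** U t)) (at t)" if t: "t \<in> J" for t
  proof -
    have "(U has_derivative (\<lambda>v. lyap_solve (\<gamma> t)
        (v *\<^sub>R (2 *\<^sub>R (U t ** \<gamma> t ** U t)) - (U t ** (v *\<^sub>R \<gamma>' t) + (v *\<^sub>R \<gamma>' t) ** U t)))) (at t)"
      using has_derivative_lyap_solve[OF d[OF t, unfolded has_vector_derivative_def]
          dd[OF t, unfolded has_vector_derivative_def] PD[OF t]] unfolding U_def .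
    moreover have "lyap_solve (\<gamma> t)
        (1 *\<^sub>R (2 *\<^sub>R (U t ** \<gamma> t ** U t)) - (U t ** (1 *\<^sub>R \<gamma>' t) + (1 *\<^sub>R \<gamma>' t) ** U t)) = - (U t ** U t)"
      by (rule lyap_solve_unique[OF PD[OF t]], subst (1 2) U_eq[OF t, symmetric])
        (simp add: matrix_mult_simps scaleR_2)
    ultimately show ?thesis using has_derivative_real_imp_has_vector_derivative by fastforce
  qed
  define V where "V = \<gamma>' 0"
  define L where "L = U 0"
  define P where "P t = mat 1 + t *\<^sub>R L" for t
  have C: "C \<in> SPD" using SPD assms by blast
  have V: "V \<in> Sym" using sym \<open>0 \<in> J\<close> by (simp add: V_def)
  have L_eq: "L = lyap_solve C V" by (simp add: L_def U_def V_def \<open>\<gamma> 0 = C\<close>)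
  have L_sym: "transpose L = L" using U_sym \<open>0 \<in> J\<close> by (simp add: L_def)
  have P_sym: "transpose (P t) = P t" for t by (simp add: P_def transpose_simps L_sym)
  have dP: "(P has_vector_derivative L) (at t)" for t
    unfolding P_def by (auto intro!: derivative_eq_intros)
  obtain k where "\<forall>(A :: real^'n^'n) (B :: real^'n^'n). norm (A ** B) \<le> norm A * norm B * k"
    using bounded_bilinear.bounded[OF bounded_bilinear_matrix_mult] by blast
  then have k: "norm (A ** B) \<le> norm A * norm B * k" for A B :: "real^'n^'n"
    by simp
  have contU: "continuous_on J U"
    using dU by (intro continuous_at_imp_continuous_on ballI has_vector_derivative_continuous) auto
  \<comment> \<open>\<open>P ** U - L\<close> solves \<open>E' = - (E ** U)\<close>.\<close>
  have PU: "P t ** U t = L" if t: "t \<in> J" for t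
  proof -
    have "P t ** U t - L = 0"
    proof (rule zero_if_norm_derivative_le[OF J(2) \<open>0 \<in> J\<close> t, where E = "\<lambda>t. P t ** U t - L"
          and E' = "\<lambda>t. - ((P t ** U t - L) ** U t)" and K = "\<lambda>t. norm (U t) * k"])
      fix s assume s: "s \<in> J"
      have "((\<lambda>t. P t ** U t - L) has_vector_derivative (P s ** (- (U s ** U s)) + L ** U s) - 0) (at s)"
        by (intro has_vector_derivative_diff has_vector_derivative_matrix_mult dP dU s
            has_vector_derivative_const)
      then show "((\<lambda>t. P t ** U t - L) has_vector_derivative - ((P s ** U s - L) ** U s)) (at s)"
        by (simp add: matrix_mult_simps)
      show "norm (- ((P s ** U s - L) ** U s)) \<le> norm (U s) * k * norm (P s ** U s - L)"
        using k[of "P s ** U s - L" "U s"] by (simp add: mult_ac)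
    next
      show "continuous_on J (\<lambda>t. norm (U t) * k)" by (intro continuous_intros contU)
    qed (simp add: P_def L_def)
    then show ?thesis by simp
  qed
  have UP: "U t ** P t = L" if t: "t \<in> J" for t
    using arg_cong[OF PU[OF t], of transpose] by (simp add: transpose_simps P_sym U_sym t L_sym)
  \<comment> \<open>\<open>\<gamma> - P ** C ** P\<close> solves \<open>D' = U ** D + D ** U\<close>, the equation of \<open>\<gamma>\<close> itself, since
    \<open>P' = L = P ** U = U ** P\<close>.\<close>
  have \<gamma>_eq: "\<gamma> t = P t ** C ** P t" if t: "t \<in> J" for t
  proof -
    let ?D = "\<lambda>t. \<gamma> t - P t ** C ** P t"
    have "?D t = 0"
    proof (rule zero_if_norm_derivative_le[OF J(2) \<open>0 \<in> J\<close> t, where E = ?D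
          and E' = "\<lambda>t. U t ** ?D t + ?D t ** U t" and K = "\<lambda>t. 2 * norm (U t) * k"])
      fix s assume s: "s \<in> J"
      have "(?D has_vector_derivative \<gamma>' s - (P s ** C ** L + (P s ** 0 + L ** C) ** P s)) (at s)"
        by (intro has_vector_derivative_diff has_vector_derivative_matrix_mult dP d s
            has_vector_derivative_const)
      moreover have "\<gamma>' s - (P s ** C ** L + (P s ** 0 + L ** C) ** P s) = U s ** ?D s + ?D s ** U s"
      proof -
        have "U s ** ?D s + ?D s ** U s
            = (U s ** \<gamma> s + \<gamma> s ** U s) - ((U s ** P s) ** C ** P s + P s ** C ** (P s ** U s))"
          by (simp add: matrix_mult_simps algebra_simps)
        then show ?thesis unfolding U_eq[OF s] UP[OF s] PU[OF s] by (simp add: add.commute)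
      qed
      ultimately show "(?D has_vector_derivative U s ** ?D s + ?D s ** U s) (at s)" by simp
      have "norm (U s ** ?D s + ?D s ** U s) \<le> norm (U s) * norm (?D s) * k + norm (?D s) * norm (U s) * k"
        by (intro norm_triangle_le add_mono k)
      then show "norm (U s ** ?D s + ?D s ** U s) \<le> 2 * norm (U s) * k * norm (?D s)"
        by (simp add: mult_ac)
    next
      show "continuous_on J (\<lambda>t. 2 * norm (U t) * k)" by (intro continuous_intros contU)
    qed (simp add: P_def \<open>\<gamma> 0 = C\<close>)
    then show ?thesis by simp
  qed
  \<comment> \<open>The times in \<open>J\<close> at which \<open>P\<close> is positive definite are also those at which it is
    semidefinite, so they form an open and closed part of \<open>J\<close>.\<close>
  let ?T = "J \<inter> P -` PD"
  have P_cont: "continuous_on A P" for A unfolding P_def by (intro continuous_intros)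
  have ker: "x = 0" if t: "t \<in> J" and x: "P t *v x = 0" for t x
  proof -
    have "L *v x = U t *v (P t *v x)" by (simp add: matrix_vector_mul_assoc UP[OF t])
    then have "L *v x = 0" by (simp add: x)
    then show ?thesis using x by (simp add: P_def matrix_vector_simps)
  qed
  have "P t \<in> PD \<longleftrightarrow> (\<forall>x. 0 \<le> x \<bullet> (P t *v x))" if t: "t \<in> J" for t
  proof
    assume pd: "P t \<in> PD"
    show "\<forall>x. 0 \<le> x \<bullet> (P t *v x)"
    proof
      fix x show "0 \<le> x \<bullet> (P t *v x)"
        using pd by (cases "x = 0") (auto simp: PD_def less_imp_le)
    qed
  next
    assume "\<forall>x. 0 \<le> x \<bullet> (P t *v x)"
    then have "P t \<in> SPD" using ker[OF t] P_sym by (intro SPD_of_nonneg) (auto simp: Sym_iff)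
    then show "P t \<in> PD" by (rule SPD_D)
  qed
  then have T_eq: "?T = J \<inter> {t. \<forall>x. 0 \<le> x \<bullet> (P t *v x)}" by auto
  have "open (P -` PD)" by (rule open_vimage[OF open_PD P_cont])
  then have 1: "openin (top_of_set J) ?T" by (auto simp: openin_open)
  have "closed {t. \<forall>x. 0 \<le> x \<bullet> (P t *v x)}"
    by (intro closed_Collect_all closed_Collect_le continuous_intros P_cont)
  then have 2: "closedin (top_of_set J) ?T" unfolding T_eq by (auto simp: closedin_closed)
  have "0 \<in> ?T" using \<open>0 \<in> J\<close> by (simp add: P_def mat_1_in_PD)
  then have "?T = J"
    using is_interval_connected[OF J(2)] 1 2 unfolding connected_clopen by blast
  then have "J \<subseteq> geo_interval C V"
    unfolding geo_interval_eq[OF C V] P_def L_eq by blast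
  moreover have "\<gamma> t = wExp C (t *\<^sub>R V)" if "t \<in> J" for t
    using \<gamma>_eq[OF that] wExp_eq[OF C Sym_scaleR[OF V], of t]
    by (simp add: lyap_solve_scaleR SPD_D C P_def L_eq)
  ultimately show ?thesis using V by blast
qed

lemma has_vector_derivative_wExp:
  fixes C V X :: "real^'n^'n"
  assumes C: "C \<in> SPD" and V: "V \<in> Sym" and X: "X \<in> Sym"
  shows "((\<lambda>t. wExp C (V + t *\<^sub>R X)) has_vector_derivative
           X + lyap C X ** C ** lyap C V + lyap C V ** C ** lyap C X) (at 0)"
proof -
  let ?L = "lyap C V" and ?M = "lyap C X"
  have lin: "lyap C (V + t *\<^sub>R X) = ?L + t *\<^sub>R ?M" for t
    using assms by (simp add: lyap_eq_lyap_solve Sym_add Sym_scaleR lyap_solve_add lyap_solve_scaleR SPD_D)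
  have d: "((\<lambda>t. ?L + t *\<^sub>R ?M) has_vector_derivative ?M) (at 0)"
    by (auto intro!: derivative_eq_intros)
  have "((\<lambda>t. (C + (V + t *\<^sub>R X)) + (?L + t *\<^sub>R ?M) ** C ** (?L + t *\<^sub>R ?M)) has_vector_derivative
      X + ((?L + 0 *\<^sub>R ?M) ** C ** ?M + ((?L + 0 *\<^sub>R ?M) ** 0 + ?M ** C) ** (?L + 0 *\<^sub>R ?M))) (at 0)"
    by (rule has_vector_derivative_add, (auto intro!: derivative_eq_intros)[1],
        intro has_vector_derivative_matrix_mult d has_vector_derivative_const)
  then show ?thesis unfolding wExp_def lin by (simp add: add_ac)
qed

theorem proposition11:
  fixes C :: "real^'n^'n"
  assumes "C \<in> SPD"
  shows
    "(\<forall>V\<in>Sym. open (geo_interval C V) \<and> is_interval (geo_interval C V) \<and> 0 \<in> geo_interval C V \<and>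
        geodesic_on Sym SPD wasserstein (geo_interval C V) (\<lambda>\<theta>. wExp C (\<theta> *\<^sub>R V)) \<and>
        wExp C (0 *\<^sub>R V) = C) \<and>
     (\<forall>J \<gamma>. geodesic_on Sym SPD wasserstein J \<gamma> \<and> 0 \<in> J \<and> \<gamma> 0 = C \<longrightarrow>
        (\<exists>V\<in>Sym. J \<subseteq> geo_interval C V \<and> (\<forall>\<theta>\<in>J. \<gamma> \<theta> = wExp C (\<theta> *\<^sub>R V)))) \<and>
     openin (top_of_set Sym) (exp_domain C) \<and>
     diffeomorphism Sym (exp_domain C) SPD (wExp C) (wLog C) \<and>
     (\<forall>V\<in>Sym. \<forall>X\<in>Sym.
        ((\<lambda>t. wExp C (V + t *\<^sub>R X)) has_vector_derivative
           X + lyap C X ** C ** lyap C V + lyap C V ** C ** lyap C X) (at 0))"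
proof (intro conjI ballI allI impI)
  fix V :: "real^'n^'n" assume V: "V \<in> Sym"
  show "open (geo_interval C V)" "is_interval (geo_interval C V)" "0 \<in> geo_interval C V"
    using geo_interval_open_interval[OF assms V] by blast+
  show "geodesic_on Sym SPD wasserstein (geo_interval C V) (\<lambda>\<theta>. wExp C (\<theta> *\<^sub>R V))"
    by (rule geodesic_wExp[OF assms V])
  show "wExp C (0 *\<^sub>R V) = C" using wExp_scaleR_eq[OF assms V, of 0] by simp
next
  fix J :: "real set" and \<gamma> :: "real \<Rightarrow> real^'n^'n"
  assume "geodesic_on Sym SPD wasserstein J \<gamma> \<and> 0 \<in> J \<and> \<gamma> 0 = C"
  then show "\<exists>V\<in>Sym. J \<subseteq> geo_interval C V \<and> (\<forall>\<theta>\<in>J. \<gamma> \<theta> = wExp C (\<theta> *\<^sub>R V))"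
    by (intro geodesic_eq_wExp) auto
next
  show "openin (top_of_set Sym) (exp_domain C)" by (rule openin_exp_domain[OF assms])
  show "diffeomorphism Sym (exp_domain C) SPD (wExp C) (wLog C)"
    by (rule diffeomorphism_wExp[OF assms])
next
  fix V X :: "real^'n^'n" assume "V \<in> Sym" "X \<in> Sym"
  then show "((\<lambda>t. wExp C (V + t *\<^sub>R X)) has_vector_derivative
      X + lyap C X ** C ** lyap C V + lyap C V ** C ** lyap C X) (at 0)"
    by (rule has_vector_derivative_wExp[OF assms])
qed

end
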